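(* Consider, with $\epsilon>0$, the initial boundary value problem $$PU_t+(A_i(V)U)_{x_i}+A_i^T(V)U_{x_i}+C(V)U=\epsilon(D_i(U))_{x_i},\quad t\ge0,\ \vec x\in\Omega,$$ $$U(\vec x,0)=F(\vec x)\ \text{ in }\Omega,\qquad B(V)U=G(\vec x,t)\ \text{ on }\partial\Omega,\ t\ge0,$$ with the setting and the notions of energy boundedness described in the context. (i) The problem is energy bounded if $$C+C^T=0,\qquad U_{x_i}^TD_i\ge0\quad\text{for each } i=1,2,\dots,k\ (\text{no summation}),$$ and the boundary conditions $B(V)U=G$ for $G=0$ lead to $$\oint_{\partial\Omega}\big(U^T(n_iA_i)U-\epsilon\,U^T(n_iD_i)\big)\,ds\ge0.$$ (ii) The problem is strongly energy bounded if it is energy bounded and the boundary conditions $B(V)U=G$ for $G\ne0$ lead to $$\oint_{\partial\Omega}\big(U^T(n_iA_i)U-\epsilon\,U^T(n_iD_i)\big)\,ds\ge-\oint_{\partial\Omega}G^TG\,ds,$$ where $G=G(\vec x,t)$ is independent of the solution $U$.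
   Context: $\Omega$ is the spatial domain with coordinates $\vec x=(x_1,\dots,x_k)$ and boundary $\partial\Omega$, $(n_1,\dots,n_k)^T$ is the outward pointing unit normal on $\partial\Omega$, and $ds$ is the surface element. Unless stated otherwise, repeated indices $i$ are summed over $i=1,\dots,k$ (Einstein convention). $U$ is an $n$-component vector. $P$ is a symmetric positive definite (or semi-definite), time-independent $n\times n$ matrix that is not a function of $U$; it defines the energy norm (or semi-norm) $\|U\|_P^2=\int_\Omega U^TPU\,d\Omega$. $A_i,C$ are $n\times n$ matrices that are smooth functions of the $n$-component vector $V$; the problem is linear if $V\ne U$ and nonlinear if $V=U$. The viscous fluxes $D_i=D_i(U)$ are $n$-vectors containing first derivatives of $U$, and $\epsilon$ is a parameter measuring the influence of viscous forces. $B$ is the boundary operator, $G$ the boundary data and $F$ the initial data. $U$ and $V$ are assumed smooth. Definitions. The problem is energy bounded if $\|U\|_P^2\le\|F\|_P^2$ for a minimal number of homogeneous ($G=0$) boundary conditions $B(V)U=G$. It is strongly energy bounded if $$\|U\|_P^2\le\|F\|_P^2+\int_0^t\Big(\oint_{\partial\Omega}G^TG\,ds\Big)dt$$ for a minimal number of non-homogeneous ($G\neq0$) boundary conditions $B(V)U=G$. Here a minimal number of boundary conditions refers to the number of boundary conditions required for a bound.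
   Formalization: In (ii) the bound carries 2∫∮G^TG (or constant 1 if the lower bound is −½∮G^TG), as the printed constant is false; (ii) also assumes C+C^T=0 and U_{x_i}^T D_i≥0; minimality of the number of boundary conditions is assumed in (i); Ω is bounded Lipschitz. *)

theory Defs
  imports "HOL-Analysis.Analysis"
begin

section \<open>Smooth functions\<close>

primrec ck_on :: "nat \<Rightarrow> 'a::euclidean_space set \<Rightarrow> ('a \<Rightarrow> 'b::real_normed_vector) \<Rightarrow> bool" where
  "ck_on 0 S f \<longleftrightarrow> continuous_on S f"
| "ck_on (Suc k) S f \<longleftrightarrow>
     (\<forall>x\<in>S. f differentiable (at x)) \<and>
     (\<forall>v. ck_on k S (\<lambda>x. frechet_derivative f (at x) v))"

definition smooth_near :: "'a::euclidean_space set \<Rightarrow> ('a \<Rightarrow> 'b::real_normed_vector) \<Rightarrow> bool" where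
  "smooth_near K f \<longleftrightarrow> (\<exists>S. open S \<and> K \<subseteq> S \<and> (\<forall>k. ck_on k S f))"


section \<open>Lipschitz domains, surface measure and outward unit normal\<close>

definition grad :: "(real^'k \<Rightarrow> real) \<Rightarrow> real^'k \<Rightarrow> real^'k" where
  "grad \<gamma> x = (\<chi> i. frechet_derivative \<gamma> (at x) (axis i 1))"

text \<open>
  Inside \<open>W\<close> the set \<open>\<Omega>\<close> is the part below the graph of \<open>\<gamma>\<close> in direction \<open>e\<close>. The
  height \<open>\<gamma>\<close> is a function on the hyperplane orthogonal to \<open>e\<close>, represented as a function
  on the whole space that is constant along \<open>e\<close>. The last clause holds for every Lipschitz
  function (Rademacher's theorem).
\<close>
definition graph_chart ::
    "(real^'k) set \<Rightarrow> (real^'k) set \<Rightarrow> real^'k \<Rightarrow> (real^'k \<Rightarrow> real) \<Rightarrow> bool" where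
  "graph_chart \<Omega> W e \<gamma> \<longleftrightarrow>
     open W \<and> norm e = 1 \<and>
     (\<forall>x s. \<gamma> (x + s *\<^sub>R e) = \<gamma> x) \<and>
     \<Omega> \<inter> W = {x \<in> W. x \<bullet> e < \<gamma> x} \<and>
     (\<exists>L. L-lipschitz_on UNIV \<gamma>) \<and>
     (AE x in lborel. \<gamma> differentiable (at x))"

definition graph_point :: "real^'k \<Rightarrow> (real^'k \<Rightarrow> real) \<Rightarrow> real^'k \<Rightarrow> real^'k" where
  "graph_point e \<gamma> x = x + (\<gamma> x - x \<bullet> e) *\<^sub>R e"

definition lipschitz_domain :: "(real^'k) set \<Rightarrow> bool" where
  "lipschitz_domain \<Omega> \<longleftrightarrow>
     open \<Omega> \<and> bounded \<Omega> \<and> (\<forall>p\<in>frontier \<Omega>. \<exists>W e \<gamma>. p \<in> W \<and> graph_chart \<Omega> W e \<gamma>)"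

text \<open>
  The classical formula \<open>ds = sqrt (1 + \<bar>grad \<gamma>\<bar>\<^sup>2) dx'\<close> in every chart, where \<open>dx'\<close>
  is Lebesgue measure on the hyperplane orthogonal to \<open>e\<close>. Since \<open>grad \<gamma>\<close> is orthogonal
  to the unit vector \<open>e\<close>, the density is \<open>norm (e - grad \<gamma> x)\<close>; since the integrand is
  constant along \<open>e\<close>, the integral over the hyperplane equals the Lebesgue integral over the
  slab \<open>0 \<le> x \<bullet> e \<le> 1\<close>. For one space dimension this is counting measure on the boundary.
\<close>
definition surface_measure :: "(real^'k) set \<Rightarrow> (real^'k) measure \<Rightarrow> bool" where
  "surface_measure \<Omega> \<sigma> \<longleftrightarrow>
     sets \<sigma> = sets borel \<and>
     (\<forall>W e \<gamma>. graph_chart \<Omega> W e \<gamma> \<longrightarrow>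
       (\<forall>E\<in>sets borel. E \<subseteq> frontier \<Omega> \<inter> W \<longrightarrow>
          emeasure \<sigma> E =
            (\<integral>\<^sup>+ x\<in>{x. 0 \<le> x \<bullet> e \<and> x \<bullet> e \<le> 1 \<and> graph_point e \<gamma> x \<in> E}.
               ennreal (norm (e - grad \<gamma> x)) \<partial>lborel)))"

text \<open>
  The normal is prescribed at the points where the boundary has a tangent plane, that is,
  almost everywhere; elsewhere (edges, corners) its value is irrelevant.
\<close>
definition outward_unit_normal :: "(real^'k) set \<Rightarrow> (real^'k \<Rightarrow> real^'k) \<Rightarrow> bool" where
  "outward_unit_normal \<Omega> \<nu> \<longleftrightarrow>
     \<nu> \<in> borel_measurable borel \<and>
     (\<forall>W e \<gamma> x. graph_chart \<Omega> W e \<gamma> \<and> graph_point e \<gamma> x \<in> W \<and> \<gamma> differentiable (at x) \<longrightarrow>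
        \<nu> (graph_point e \<gamma> x) = (1 / norm (e - grad \<gamma> x)) *\<^sub>R (e - grad \<gamma> x))"


section \<open>The initial boundary value problem\<close>

text \<open>Time-dependent vector fields, written \<open>U t x\<close>.\<close>
type_synonym ('k, 'n) field = "real \<Rightarrow> real^'k \<Rightarrow> real^'n"

text \<open>
  The argument \<open>V\<close> of the coefficients: either a given field (linear problem) or the
  solution itself (nonlinear problem, \<open>V = U\<close>).
\<close>
datatype ('k, 'n) coeff_arg = Given "real \<Rightarrow> real^'k \<Rightarrow> real^'n" | Self

text \<open>
  \<open>Dflux pr i u p\<close> is the \<open>i\<close>-th viscous flux at a state \<open>u\<close> with first derivatives
  \<open>p $ j\<close> (the derivative of \<open>U\<close> with respect to \<open>x\<^sub>j\<close>). The boundary operator consists of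
  \<open>nbc pr\<close> scalar conditions; \<open>bop pr V U t x r\<close> is component \<open>r < nbc pr\<close> of \<open>B(V)U\<close> at
  the boundary point \<open>x\<close> and time \<open>t\<close>. It receives the whole fields, so it may involve
  derivatives, and it may depend on \<open>x\<close>, for instance through the normal.
\<close>
record ('k, 'n) ibvp =
  region :: "(real^'k) set"
  surf :: "(real^'k) measure"
  nrm :: "real^'k \<Rightarrow> real^'k"
  Pmat :: "real^'k \<Rightarrow> real^'n^'n"
  Amat :: "'k \<Rightarrow> real^'n \<Rightarrow> real^'n^'n"
  Cmat :: "real^'n \<Rightarrow> real^'n^'n"
  Dflux :: "'k \<Rightarrow> real^'n \<Rightarrow> real^'n^'k \<Rightarrow> real^'n"
  eps :: real
  coeff :: "('k, 'n) coeff_arg"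
  nbc :: nat
  bop :: "(real \<Rightarrow> real^'k \<Rightarrow> real^'n) \<Rightarrow> (real \<Rightarrow> real^'k \<Rightarrow> real^'n) \<Rightarrow> real \<Rightarrow> real^'k \<Rightarrow> nat \<Rightarrow> real"

definition V_of :: "('k::finite, 'n::finite) ibvp \<Rightarrow> ('k, 'n) field \<Rightarrow> ('k, 'n) field" where
  "V_of pr U = (case coeff pr of Given V \<Rightarrow> V | Self \<Rightarrow> U)"

text \<open>Smooth up to the boundary and up to the initial time.\<close>
definition smooth_field :: "(real^'k) set \<Rightarrow> ('k::finite, 'n::finite) field \<Rightarrow> bool" where
  "smooth_field \<Omega> U \<longleftrightarrow> smooth_near ({0..} \<times> closure \<Omega>) (\<lambda>(t, x). U t x)"

definition ibvp_setting :: "('k::finite, 'n::finite) ibvp \<Rightarrow> bool" where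
  "ibvp_setting pr \<longleftrightarrow>
     lipschitz_domain (region pr) \<and>
     surface_measure (region pr) (surf pr) \<and>
     outward_unit_normal (region pr) (nrm pr) \<and>
     continuous_on (closure (region pr)) (Pmat pr) \<and>
     (\<forall>x\<in>closure (region pr).
        transpose (Pmat pr x) = Pmat pr x \<and> (\<forall>v. v \<bullet> (Pmat pr x *v v) \<ge> 0)) \<and>
     (\<forall>i. smooth_near UNIV (Amat pr i)) \<and>
     smooth_near UNIV (Cmat pr) \<and>
     (\<forall>i. smooth_near UNIV (\<lambda>(u, p). Dflux pr i u p)) \<and>
     (\<forall>V. coeff pr = Given V \<longrightarrow> smooth_field (region pr) V)"

definition dx :: "'k \<Rightarrow> (real^'k \<Rightarrow> real^'n) \<Rightarrow> real^'k \<Rightarrow> real^'n" where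
  "dx i f x = frechet_derivative f (at x) (axis i 1)"

definition visc :: "('k::finite, 'n::finite) ibvp \<Rightarrow> 'k \<Rightarrow> (real^'k \<Rightarrow> real^'n) \<Rightarrow> real^'k \<Rightarrow> real^'n" where
  "visc pr i u x = Dflux pr i (u x) (\<chi> j. dx j u x)"

definition pde_at :: "('k::finite, 'n::finite) ibvp \<Rightarrow> ('k, 'n) field \<Rightarrow> real \<Rightarrow> real^'k \<Rightarrow> bool" where
  "pde_at pr U t x \<longleftrightarrow>
     (let V = V_of pr U in
       Pmat pr x *v vector_derivative (\<lambda>s. U s x) (at t)
       + (\<Sum>i\<in>UNIV. dx i (\<lambda>y. Amat pr i (V t y) *v U t y) x
                    + transpose (Amat pr i (V t x)) *v dx i (U t) x)
       + Cmat pr (V t x) *v U t x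
       = eps pr *\<^sub>R (\<Sum>i\<in>UNIV. dx i (visc pr i (U t)) x))"

text \<open>
  \<open>G t x r\<close> is component \<open>r\<close> of the boundary data. In the following definitions \<open>J\<close> is the
  set of those conditions that are imposed; the full problem is \<open>J = {..<nbc pr}\<close>.
\<close>
type_synonym 'k bdata = "real \<Rightarrow> real^'k \<Rightarrow> nat \<Rightarrow> real"

definition data_energy :: "('k::finite, 'n::finite) ibvp \<Rightarrow> nat set \<Rightarrow> 'k bdata \<Rightarrow> real \<Rightarrow> real" where
  "data_energy pr J G t = (LINT x:frontier (region pr)|surf pr. (\<Sum>r\<in>J. (G t x r)\<^sup>2))"

text \<open>Data for which the integrals of \<open>G\<^sup>T G\<close> over the boundary and over time exist.\<close>
definition admissible_data :: "('k::finite, 'n::finite) ibvp \<Rightarrow> nat set \<Rightarrow> 'k bdata \<Rightarrow> bool" where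
  "admissible_data pr J G \<longleftrightarrow>
     (\<forall>t\<ge>0. set_integrable (surf pr) (frontier (region pr)) (\<lambda>x. \<Sum>r\<in>J. (G t x r)\<^sup>2)) \<and>
     (\<forall>T\<ge>0. set_integrable lborel {0..T} (data_energy pr J G))"

definition is_solution ::
    "('k::finite, 'n::finite) ibvp \<Rightarrow> nat set \<Rightarrow> (real^'k \<Rightarrow> real^'n) \<Rightarrow> 'k bdata \<Rightarrow>
     ('k, 'n) field \<Rightarrow> bool" where
  "is_solution pr J F G U \<longleftrightarrow>
     admissible_data pr J G \<and>
     smooth_field (region pr) U \<and>
     (\<forall>t\<ge>0. \<forall>x\<in>region pr. pde_at pr U t x) \<and>
     (\<forall>x\<in>region pr. U 0 x = F x) \<and>
     (\<forall>t\<ge>0. \<forall>x\<in>frontier (region pr). \<forall>r\<in>J. bop pr (V_of pr U) U t x r = G t x r)"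

definition energy :: "('k::finite, 'n::finite) ibvp \<Rightarrow> (real^'k \<Rightarrow> real^'n) \<Rightarrow> real" where
  "energy pr u = (LINT x:region pr|lborel. u x \<bullet> (Pmat pr x *v u x))"

definition boundary_term :: "('k::finite, 'n::finite) ibvp \<Rightarrow> ('k, 'n) field \<Rightarrow> real \<Rightarrow> real" where
  "boundary_term pr U t =
     (LINT x:frontier (region pr)|surf pr.
        U t x \<bullet> ((\<Sum>i\<in>UNIV. nrm pr x $ i *\<^sub>R Amat pr i (V_of pr U t x)) *v U t x)
        - eps pr * (U t x \<bullet> (\<Sum>i\<in>UNIV. nrm pr x $ i *\<^sub>R visc pr i (U t) x)))"


section \<open>Energy boundedness\<close>

definition energy_estimate :: "('k::finite, 'n::finite) ibvp \<Rightarrow> nat set \<Rightarrow> bool" where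
  "energy_estimate pr J \<longleftrightarrow>
     (\<forall>F U. is_solution pr J F (\<lambda>_ _ _. 0) U \<longrightarrow> (\<forall>t\<ge>0. energy pr (U t) \<le> energy pr F))"

text \<open>
  \<open>\<kappa> = 1\<close> is the estimate in its usual normalisation. The factor is a parameter because the
  energy identity has the form \<open>1/2 d/dt \<parallel>U\<parallel>\<^sup>2 + \<dots> = 0\<close>: a lower bound \<open>- c \<oint> G\<^sup>T G ds\<close> of the
  boundary term yields \<open>\<kappa> = 2 c\<close>, and no smaller \<open>\<kappa>\<close> in general.
\<close>
definition strong_energy_estimate :: "real \<Rightarrow> ('k::finite, 'n::finite) ibvp \<Rightarrow> nat set \<Rightarrow> bool" where
  "strong_energy_estimate \<kappa> pr J \<longleftrightarrow>
     (\<forall>F G U. is_solution pr J F G U \<longrightarrow>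
        (\<forall>t\<ge>0. energy pr (U t) \<le> energy pr F + \<kappa> * (LINT s:{0..t}|lborel. data_energy pr J G s)))"

text \<open>
  No smaller number of the conditions \<open>B(V)U = G\<close> gives the bound. Minimality is measured
  among the given conditions: one scalar equation can encode several (for instance
  \<open>U\<^sup>T U = 0\<close>, of the form \<open>B(V)U = 0\<close> with \<open>B(V) = V\<^sup>T\<close>, \<open>V = U\<close>), so that counting over
  all conceivable operators would be meaningless.
\<close>
definition minimal_conditions ::
    "(('k::finite, 'n::finite) ibvp \<Rightarrow> nat set \<Rightarrow> bool) \<Rightarrow> ('k, 'n) ibvp \<Rightarrow> bool" where
  "minimal_conditions bound pr \<longleftrightarrow>
     (\<forall>J. J \<subseteq> {..<nbc pr} \<and> card J < nbc pr \<longrightarrow> \<not> bound pr J)"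

definition energy_bounded :: "('k::finite, 'n::finite) ibvp \<Rightarrow> bool" where
  "energy_bounded pr \<longleftrightarrow>
     energy_estimate pr {..<nbc pr} \<and> minimal_conditions energy_estimate pr"

definition strongly_energy_bounded :: "real \<Rightarrow> ('k::finite, 'n::finite) ibvp \<Rightarrow> bool" where
  "strongly_energy_bounded \<kappa> pr \<longleftrightarrow>
     strong_energy_estimate \<kappa> pr {..<nbc pr} \<and> minimal_conditions (strong_energy_estimate \<kappa>) pr"

definition nonzero_data :: "('k::finite, 'n::finite) ibvp \<Rightarrow> 'k bdata \<Rightarrow> bool" where
  "nonzero_data pr G \<longleftrightarrow> (\<exists>t\<ge>0. \<exists>x\<in>frontier (region pr). \<exists>r<nbc pr. G t x r \<noteq> 0)"

text \<open>The boundary conditions with \<open>G \<noteq> 0\<close> lead to the lower bound \<open>- c \<oint> G\<^sup>T G ds\<close>.\<close>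
definition data_lower_bound :: "real \<Rightarrow> ('k::finite, 'n::finite) ibvp \<Rightarrow> bool" where
  "data_lower_bound c pr \<longleftrightarrow>
     (\<forall>F G U. is_solution pr {..<nbc pr} F G U \<and> nonzero_data pr G \<longrightarrow>
        (\<forall>t\<ge>0. boundary_term pr U t \<ge> - c * data_energy pr {..<nbc pr} G t))"

end

theory Submission
  imports Defs
begin

text \<open>
  The proof is the energy method. Multiply the equation by \<open>U\<^sup>T\<close>. The split form of the convective
  term is chosen so that \<open>U\<^sup>T (A\<^sub>i U)\<^sub>x + U\<^sup>T A\<^sub>i\<^sup>T U\<^sub>x\<close> is the exact derivative of \<open>U\<^sup>T A\<^sub>i U\<close>,
  whether or not \<open>A\<^sub>i\<close> depends on \<open>U\<close>. The term with the skew matrix \<open>C\<close> vanishes, and the viscous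
  term is an exact derivative minus the dissipation \<open>\<epsilon> U\<^sub>x\<^sup>T D\<^sub>i \<ge> 0\<close>. Integrating over the region, the
  divergence theorem shows that the energy grows at a rate of at most minus twice the boundary term
  (\<open>energy_rate_le_boundary_term\<close>). A lower bound for the boundary term, integrated over time, is
  therefore a bound for the energy (\<open>energy_le_of_boundary_bound\<close>); zero as a lower bound gives the
  energy estimate and \<open>- c \<integral> G\<^sup>T G\<close> the strong one with factor \<open>2 c\<close>. Minimality of the number of
  conditions passes from the plain to the strong estimate, because the latter implies the former.

  Most of the work is the divergence theorem on a bounded Lipschitz domain, with the surface measure
  and the normal given by graph charts (\<open>Gauss_theorem\<close>). For a function \<open>f\<close> with compact support
  and the region \<open>A\<close> below a graph in direction \<open>e\<close>, consider
  \<open>\<integral>(1\<^sub>A(x - hv) - 1\<^sub>A(x)) f(x) dx / h\<close>. Moving the shift to \<open>f\<close>, the limit for small \<open>h\<close> is the integral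
  of the derivative of \<open>f\<close> in direction \<open>v\<close> over \<open>A\<close> (\<open>shifted_volume_tendsto\<close>). Slicing along \<open>e\<close>
  instead, on each line the shift only moves the end point of a half-line, and the limit is the value of
  \<open>f\<close> on the graph times \<open>v \<bullet> (e - grad \<gamma>)\<close> (\<open>shifted_slab_tendsto\<close>), that is, the surface integral.
  A telescoping product of cutoffs passes from one chart to the whole domain.
\<close>

section \<open>Integration along a direction\<close>

text \<open>
  Fubini's theorem along an arbitrary unit vector \<open>e\<close>, without a choice of coordinates: every
  line parallel to \<open>e\<close> meets the slab in a segment of length one, so integrating over all points
  of the slab and over all lines through them counts each point of space exactly once. The
  slab is the same one that represents the hyperplane orthogonal to \<open>e\<close> in the surface measure.
\<close>
lemma lborel_eq_slab_sweep:
  fixes e :: "'a::euclidean_space"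
  assumes "norm e = 1"
  shows "distr (density (lborel \<Otimes>\<^sub>M lborel) (indicator ({x. 0 \<le> x \<bullet> e \<and> x \<bullet> e \<le> 1} \<times> UNIV)))
           borel (\<lambda>(x, s). x + s *\<^sub>R e) = (lborel :: 'a measure)" (is "distr ?D _ ?h = _")
proof (rule measure_eqI)
  let ?S = "{x. 0 \<le> x \<bullet> e \<and> x \<bullet> e \<le> 1}"
  have S[measurable]: "?S \<in> sets borel"
    by measurable
  have h[measurable]: "?h \<in> borel_measurable (lborel \<Otimes>\<^sub>M lborel)"
    by measurable
  fix E :: "'a set" assume "E \<in> sets (distr ?D borel ?h)"
  then have E[measurable]: "E \<in> sets borel" by simp
  have SE[measurable]: "?S \<times> (UNIV::real set) \<in> sets (lborel \<Otimes>\<^sub>M lborel)"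
    by (intro pair_measureI) auto
  have vE: "?h -` E \<inter> space ?D \<in> sets (lborel \<Otimes>\<^sub>M lborel)"
    using measurable_sets[OF h E] by simp
  have "emeasure (distr ?D borel ?h) E = emeasure ?D (?h -` E \<inter> space ?D)"
    by (rule emeasure_distr) auto
  also have "\<dots> = (\<integral>\<^sup>+ z. indicator (?S \<times> UNIV) z * indicator (?h -` E \<inter> space ?D) z \<partial>(lborel \<Otimes>\<^sub>M lborel))"
    by (rule emeasure_density) (use SE vE in auto)
  also have "\<dots> = (\<integral>\<^sup>+ z. indicator ?S (fst z) * indicator E (fst z + snd z *\<^sub>R e) \<partial>(lborel \<Otimes>\<^sub>M lborel))"
    by (intro nn_integral_cong) (auto simp: indicator_def space_pair_measure split: prod.splits)
  also have "\<dots> = (\<integral>\<^sup>+ s. (\<integral>\<^sup>+ x. indicator ?S x * indicator E (x + s *\<^sub>R e) \<partial>lborel) \<partial>lborel)"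
    by (subst lborel_pair.nn_integral_snd[symmetric]) auto
  \<comment> \<open>For fixed \<open>s\<close>, translate \<open>x\<close> by \<open>s e\<close>; the shift passes from \<open>E\<close> to the slab.\<close>
  also have "\<dots> = (\<integral>\<^sup>+ s. (\<integral>\<^sup>+ x. indicator ?S (x - s *\<^sub>R e) * indicator E x \<partial>lborel) \<partial>lborel)"
  proof (rule nn_integral_cong)
    fix s :: real
    have "(\<integral>\<^sup>+ x. indicator ?S (x - s *\<^sub>R e) * indicator E x \<partial>lborel)
        = (\<integral>\<^sup>+ x. indicator ?S (x - s *\<^sub>R e) * indicator E x \<partial>(distr lborel borel ((+) (s *\<^sub>R e))))"
      by (simp add: lborel_distr_plus)
    also have "\<dots> = (\<integral>\<^sup>+ x. indicator ?S (s *\<^sub>R e + x - s *\<^sub>R e) * indicator E (s *\<^sub>R e + x) \<partial>lborel)"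
      by (subst nn_integral_distr) auto
    finally show "(\<integral>\<^sup>+ x. indicator ?S x * indicator E (x + s *\<^sub>R e) \<partial>lborel)
        = (\<integral>\<^sup>+ x. indicator ?S (x - s *\<^sub>R e) * indicator E x \<partial>lborel)"
      by (simp add: add.commute)
  qed
  also have "\<dots> = (\<integral>\<^sup>+ x. (\<integral>\<^sup>+ s. indicator ?S (x - s *\<^sub>R e) * indicator E x \<partial>lborel) \<partial>lborel)"
    by (subst lborel_pair.Fubini'[symmetric]) auto
  also have "\<dots> = (\<integral>\<^sup>+ x. indicator E x \<partial>lborel)"
  proof (rule nn_integral_cong)
    fix x :: 'a
    have "e \<bullet> e = 1"
      using assms by (simp add: dot_square_norm)
    then have "(\<integral>\<^sup>+ s. indicator ?S (x - s *\<^sub>R e) * indicator E x \<partial>lborel)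
        = (\<integral>\<^sup>+ s. indicator E x * indicator {x \<bullet> e - 1 .. x \<bullet> e} s \<partial>lborel)"
      by (intro nn_integral_cong) (auto simp: indicator_def inner_diff_left)
    also have "\<dots> = indicator E x"
      by (subst nn_integral_cmult) auto
    finally show "(\<integral>\<^sup>+ s. indicator ?S (x - s *\<^sub>R e) * indicator E x \<partial>lborel) = indicator E x" .
  qed
  also have "\<dots> = emeasure lborel E"
    by simp
  finally show "emeasure (distr ?D borel ?h) E = emeasure lborel E" .
qed simp

lemma slab_Fubini:
  fixes f :: "'a::euclidean_space \<Rightarrow> real"
  assumes e: "norm e = 1" and f: "integrable lborel f"
  defines "S \<equiv> {x. 0 \<le> x \<bullet> e \<and> x \<bullet> e \<le> 1}"
  shows "(\<integral>x. f x \<partial>lborel) = (\<integral>x. indicator S x * (\<integral>s. f (x + s *\<^sub>R e) \<partial>lborel) \<partial>lborel)"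
    and "integrable lborel (\<lambda>x. indicator S x * (\<integral>s. f (x + s *\<^sub>R e) \<partial>lborel))"
proof -
  let ?L = "lborel \<Otimes>\<^sub>M lborel :: ('a \<times> real) measure"
  let ?I = "indicator (S \<times> (UNIV :: real set)) :: 'a \<times> real \<Rightarrow> real"
  have S[measurable]: "S \<in> sets borel"
    unfolding S_def by measurable
  have SE[measurable]: "S \<times> (UNIV::real set) \<in> sets ?L"
    by (intro pair_measureI) auto
  have fm[measurable]: "f \<in> borel_measurable borel"
    using f by auto
  have ind: "indicator (S \<times> UNIV) = (\<lambda>z. ennreal (?I z))"
    by (auto simp: indicator_def)
  have lb: "lborel = distr (density ?L (\<lambda>z. ennreal (?I z))) borel (\<lambda>(x, s). x + s *\<^sub>R e)"
    by (rule lborel_eq_slab_sweep[OF e, folded S_def, unfolded ind, symmetric])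
  have int1: "integrable (density ?L (\<lambda>z. ennreal (?I z))) (\<lambda>z. f (case z of (x, s) \<Rightarrow> x + s *\<^sub>R e))"
    using f by (subst (asm) lb, subst (asm) integrable_distr_eq) auto
  then have int2: "integrable ?L (\<lambda>z. ?I z *\<^sub>R f (case z of (x, s) \<Rightarrow> x + s *\<^sub>R e))"
    by (subst (asm) integrable_density) auto
  have "(\<integral>x. f x \<partial>lborel) = (\<integral>z. f (case z of (x, s) \<Rightarrow> x + s *\<^sub>R e) \<partial>density ?L (\<lambda>z. ennreal (?I z)))"
    by (subst lb, subst integral_distr) auto
  also have "\<dots> = (\<integral>z. ?I z *\<^sub>R f (case z of (x, s) \<Rightarrow> x + s *\<^sub>R e) \<partial>?L)"
    by (subst integral_density) auto
  also have "\<dots> = (\<integral>x. (\<integral>s. ?I (x, s) *\<^sub>R f (case (x, s) of (x, s) \<Rightarrow> x + s *\<^sub>R e) \<partial>lborel) \<partial>lborel)"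
    by (subst lborel_pair.integral_fst'[OF int2]) simp
  also have "\<dots> = (\<integral>x. indicator S x * (\<integral>s. f (x + s *\<^sub>R e) \<partial>lborel) \<partial>lborel)"
    by (intro Bochner_Integration.integral_cong refl) (auto simp: indicator_def)
  finally show "(\<integral>x. f x \<partial>lborel) = (\<integral>x. indicator S x * (\<integral>s. f (x + s *\<^sub>R e) \<partial>lborel) \<partial>lborel)" .
  have "integrable lborel (\<lambda>x. (\<integral>s. ?I (x, s) *\<^sub>R f (case (x, s) of (x, s) \<Rightarrow> x + s *\<^sub>R e) \<partial>lborel))"
    by (rule lborel_pair.integrable_fst'[OF int2])
  also have "(\<lambda>x. (\<integral>s. ?I (x, s) *\<^sub>R f (case (x, s) of (x, s) \<Rightarrow> x + s *\<^sub>R e) \<partial>lborel))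
     = (\<lambda>x. indicator S x * (\<integral>s. f (x + s *\<^sub>R e) \<partial>lborel))"
    by (auto simp: indicator_def)
  finally show "integrable lborel (\<lambda>x. indicator S x * (\<integral>s. f (x + s *\<^sub>R e) \<partial>lborel))" .
qed

lemma integrable_continuous_compact_support:
  fixes f :: "'a::euclidean_space \<Rightarrow> real"
  assumes "continuous_on UNIV f" and "\<And>x. norm x > R \<Longrightarrow> f x = 0"
  shows "integrable lborel f"
proof -
  have "integrable lborel (\<lambda>x. indicator (cball 0 R) x *\<^sub>R f x)"
    by (rule borel_integrable_compact) (auto intro: continuous_on_subset[OF assms(1)])
  also have "(\<lambda>x. indicator (cball 0 R) x *\<^sub>R f x) = f"
    using assms(2) by (auto simp: indicator_def fun_eq_iff not_le)
  finally show ?thesis .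
qed

lemma bounded_continuous_compact_support:
  fixes f :: "'a::euclidean_space \<Rightarrow> real"
  assumes "continuous_on UNIV f" and "\<And>x. norm x > R \<Longrightarrow> f x = 0"
  shows "\<exists>M\<ge>0. \<forall>x. \<bar>f x\<bar> \<le> M"
proof -
  have "compact (f ` cball 0 R)"
    by (intro compact_continuous_image continuous_on_subset[OF assms(1)]) auto
  then obtain M where M: "\<And>y. y \<in> f ` cball 0 R \<Longrightarrow> norm y \<le> M"
    using compact_imp_bounded bounded_iff by metis
  have "\<bar>f x\<bar> \<le> max M 0" for x
    using M[of "f x"] assms(2)[of x] by (cases "norm x \<le> R") auto
  then show ?thesis
    by (intro exI[of _ "max M 0"]) auto
qed

text \<open>
  The fundamental theorem of calculus with the lower limit at minus infinity: to the left of the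
  support the integrand vanishes, so the integral can start at any point \<open>c\<close> there.
\<close>
lemma has_real_derivative_integral_lessThan:
  fixes \<psi> :: "real \<Rightarrow> real"
  assumes c: "continuous_on UNIV \<psi>" and R: "\<And>s. \<bar>s\<bar> > R \<Longrightarrow> \<psi> s = 0"
  shows "((\<lambda>a. \<integral>s. indicator {..<a} s * \<psi> s \<partial>lborel) has_real_derivative \<psi> a) (at a)"
proof -
  define c where "c = min (a - 1) (- R - 1)"
  define d where "d = a + 1"
  have *: "(\<integral>s. indicator {..<b} s * \<psi> s \<partial>lborel) = integral {c..b} \<psi>" if "b \<in> {c..d}" for b
  proof -
    have i: "set_integrable lborel {c..b} \<psi>"
      unfolding set_integrable_def by (rule borel_integrable_compact) (auto intro: continuous_on_subset[OF assms(1)])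
    have "(\<integral>s. indicator {..<b} s * \<psi> s \<partial>lborel) = (LINT s:{c..b}|lborel. \<psi> s)"
      unfolding set_lebesgue_integral_def
    proof (rule integral_cong_AE)
      show "AE s in lborel. indicator {..<b} s * \<psi> s = indicator {c..b} s *\<^sub>R \<psi> s"
        using AE_lborel_singleton[of b]
      proof eventually_elim
        case (elim s)
        have "\<psi> s = 0" if "s < c"
          using R[of s] that unfolding c_def by auto
        with elim show ?case
          by (auto simp: indicator_def)
      qed
      show "(\<lambda>s. indicator {..<b} s * \<psi> s) \<in> borel_measurable lborel"
        using borel_measurable_continuous_onI[OF assms(1)] by measurable
      show "(\<lambda>s. indicator {c..b} s *\<^sub>R \<psi> s) \<in> borel_measurable lborel"
        using borel_measurable_continuous_onI[OF assms(1)] by measurable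
    qed
    also have "\<dots> = integral {c..b} \<psi>"
      by (rule set_borel_integral_eq_integral(2)[OF i])
    finally show ?thesis .
  qed
  have "((\<lambda>b. integral {c..b} \<psi>) has_real_derivative \<psi> a) (at a within {c..d})"
    by (rule integral_has_real_derivative) (auto intro: continuous_on_subset[OF assms(1)] simp: c_def d_def)
  moreover have "at a within {c..d} = at a"
    by (rule at_within_interior) (auto simp: c_def d_def)
  ultimately have "((\<lambda>b. integral {c..b} \<psi>) has_real_derivative \<psi> a) (at a)"
    by simp
  then show ?thesis
    by (rule has_field_derivative_transform_within_open[where S="{c<..<d}"])
       (auto simp: * c_def d_def)
qed

section \<open>Difference quotients\<close>

text \<open>
  A fixed sequence of positive numbers tending to zero. All difference quotients are taken along
  it, so that dominated convergence applies and limits are measurable.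
\<close>
definition step :: "nat \<Rightarrow> real" where
  "step n = inverse (real (Suc n))"

lemma step_pos: "step n > 0" and step_le_1: "step n \<le> 1"
  by (auto simp: step_def field_simps)

lemma step_tendsto: "step \<longlonglongrightarrow> 0"
  unfolding step_def by (rule LIMSEQ_inverse_real_of_nat)

lemma difference_quotient_tendsto:
  assumes "(g has_real_derivative d) (at 0)"
  shows "(\<lambda>n. (g (step n) - g 0) / step n) \<longlonglongrightarrow> d"
proof -
  have "((\<lambda>h. (g (0 + h) - g 0) / h) \<longlongrightarrow> d) (at 0)"
    using assms by (rule DERIV_D)
  moreover have "filterlim step (at 0) sequentially"
    using step_tendsto step_pos by (auto simp: filterlim_at less_le)
  ultimately show ?thesis
    by (auto dest: filterlim_compose)
qed

lemma has_real_derivative_along_line: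
  assumes "(f has_derivative f') (at (x + s *\<^sub>R v))"
  shows "((\<lambda>s. f (x + s *\<^sub>R v)) has_real_derivative f' v) (at s)"
proof -
  have "((\<lambda>s. x + s *\<^sub>R v) has_derivative (\<lambda>s. s *\<^sub>R v)) (at s)"
    by (auto intro!: derivative_eq_intros)
  from has_derivative_compose[OF this assms]
  moreover have "(\<lambda>s. f' (s *\<^sub>R v)) = (*) (f' v)"
    using linear_cmul[OF has_derivative_linear[OF assms]] by (simp add: fun_eq_iff mult.commute)
  ultimately show ?thesis
    by (simp add: has_field_derivative_def)
qed

lemma frechet_derivative_eq_inner_grad:
  assumes "\<gamma> differentiable (at x)"
  shows "frechet_derivative \<gamma> (at x) v = v \<bullet> grad \<gamma> x"
proof -
  have lin: "linear (frechet_derivative \<gamma> (at x))"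
    by (rule linear_frechet_derivative[OF assms])
  have "frechet_derivative \<gamma> (at x) v = frechet_derivative \<gamma> (at x) (\<Sum>i\<in>UNIV. v $ i *\<^sub>R axis i 1)"
    by (simp add: basis_expansion flip: scalar_mult_eq_scaleR)
  also have "\<dots> = v \<bullet> grad \<gamma> x"
    by (simp add: linear_sum[OF lin] linear_cmul[OF lin] grad_def inner_vec_def)
  finally show ?thesis .
qed

text \<open>
  \<open>grad \<gamma> x\<close> is an unspecified value where \<open>\<gamma>\<close> is not differentiable, so \<open>grad \<gamma>\<close> need not be
  Borel measurable. The limit of difference quotients is, and it agrees with \<open>grad \<gamma>\<close> wherever
  \<open>\<gamma>\<close> is differentiable; it replaces \<open>grad \<gamma>\<close> under integrals.
\<close>
definition limit_grad :: "(real^'k \<Rightarrow> real) \<Rightarrow> real^'k \<Rightarrow> real^'k" where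
  "limit_grad \<gamma> x = (\<chi> i. lim (\<lambda>n. (\<gamma> (x + step n *\<^sub>R axis i 1) - \<gamma> x) / step n))"

lemma limit_grad_eq_grad:
  assumes "\<gamma> differentiable (at x)"
  shows "limit_grad \<gamma> x = grad \<gamma> x"
proof -
  have "(\<gamma> has_derivative frechet_derivative \<gamma> (at x)) (at (x + 0 *\<^sub>R v))" for v
    using assms by (simp add: frechet_derivative_works)
  from difference_quotient_tendsto[OF has_real_derivative_along_line[OF this]]
  show ?thesis
    by (simp add: limit_grad_def grad_def vec_eq_iff limI)
qed

lemma measurable_limit_grad:
  assumes "continuous_on UNIV \<gamma>"
  shows "limit_grad \<gamma> \<in> borel_measurable borel"
proof -
  have [measurable]: "\<gamma> \<in> borel_measurable borel"
    by (rule borel_measurable_continuous_onI[OF assms])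
  show ?thesis
    unfolding limit_grad_def
    by (subst borel_measurable_euclidean_space) (auto simp: Basis_vec_def inner_axis)
qed

lemma graph_point_measurable:
  assumes "continuous_on UNIV \<gamma>"
  shows "graph_point e \<gamma> \<in> borel_measurable borel"
  unfolding graph_point_def
  by (intro borel_measurable_continuous_onI continuous_intros assms)

lemma derivative_zero_if_locally_zero:
  fixes f :: "'a::real_normed_vector \<Rightarrow> 'b::real_normed_vector"
  assumes "(f has_derivative f') (at x)" and "open U" "x \<in> U" and "\<And>y. y \<in> U \<Longrightarrow> f y = 0"
  shows "f' v = 0"
proof -
  have "((\<lambda>_. 0) has_derivative f') (at x)"
    by (rule has_derivative_transform_within_open[OF assms(1-3)]) (use assms(4) in auto)
  then have "f' = (\<lambda>_. 0)"
    by (rule has_derivative_unique[OF _ has_derivative_const])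
  then show ?thesis by simp
qed

lemma difference_along_line_bound:
  fixes f :: "'a::real_normed_vector \<Rightarrow> real"
  assumes f: "\<And>x. (f has_derivative f' x) (at x)" and M: "\<And>x. \<bar>f' x v\<bar> \<le> M" and "h > 0"
  shows "\<bar>f (x + h *\<^sub>R v) - f x\<bar> \<le> M * h"
proof -
  have d: "((\<lambda>s. f (x + s *\<^sub>R v)) has_real_derivative f' (x + s *\<^sub>R v) v) (at s)" for s
    by (rule has_real_derivative_along_line[OF f])
  have "\<exists>z. 0 < z \<and> z < h \<and> f (x + h *\<^sub>R v) - f (x + 0 *\<^sub>R v) = (h - 0) * f' (x + z *\<^sub>R v) v"
    using \<open>h > 0\<close> d by (intro MVT2)
  then obtain z where "f (x + h *\<^sub>R v) - f x = h * f' (x + z *\<^sub>R v) v"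
    by auto
  then show ?thesis
    using M[of "x + z *\<^sub>R v"] \<open>h > 0\<close> by (simp add: abs_mult mult.commute)
qed

lemma integrable_indicator_mult:
  fixes f :: "'a \<Rightarrow> real"
  assumes "integrable M f" and "A \<in> sets M"
  shows "integrable M (\<lambda>x. indicator A x * f x)"
  using integrable_mult_indicator[OF assms(2,1)] by simp

lemma lborel_integral_translate:
  fixes f :: "'a::euclidean_space \<Rightarrow> real"
  assumes [measurable]: "f \<in> borel_measurable borel"
  shows "(\<integral>x. f (x + c) \<partial>lborel) = (\<integral>x. f x \<partial>lborel)"
proof -
  have "(\<integral>x. f x \<partial>lborel) = (\<integral>x. f x \<partial>distr lborel borel ((+) c))"
    by (simp add: lborel_distr_plus)
  also have "\<dots> = (\<integral>x. f (c + x) \<partial>lborel)"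
    by (subst integral_distr) auto
  finally show ?thesis
    by (simp add: add.commute)
qed

lemma lborel_integrable_translate:
  fixes f :: "'a::euclidean_space \<Rightarrow> real"
  assumes "integrable lborel f"
  shows "integrable lborel (\<lambda>x. f (x + c))"
proof -
  have [measurable]: "f \<in> borel_measurable borel"
    using assms by auto
  have "integrable (distr lborel borel ((+) c)) f"
    using assms by (simp add: lborel_distr_plus)
  then show ?thesis
    by (subst (asm) integrable_distr_eq) (auto simp: add.commute)
qed

section \<open>The region below a Lipschitz graph\<close>

text \<open>
  Translation invariance moves the shift from the set to the function:
  \<open>\<integral>(1\<^sub>A(x - hv) - 1\<^sub>A(x)) f(x) dx = \<integral>1\<^sub>A(x) (f(x + hv) - f(x)) dx\<close>. After division by \<open>h\<close> the
  right-hand side tends to the integral of the directional derivative over \<open>A\<close>.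
\<close>
lemma shifted_volume_tendsto:
  fixes f :: "'a::euclidean_space \<Rightarrow> real"
  assumes f: "\<And>x. (f has_derivative f' x) (at x)"
    and f': "continuous_on UNIV (\<lambda>x. f' x v)"
    and R: "\<And>x. norm x > R \<Longrightarrow> f x = 0"
    and A[measurable]: "A \<in> sets borel"
  shows "(\<lambda>n. (\<integral>x. (indicator A (x - step n *\<^sub>R v) - indicator A x) * f x \<partial>lborel) / step n)
           \<longlonglongrightarrow> (\<integral>x. indicator A x * f' x v \<partial>lborel)"
proof -
  have contf: "continuous_on UNIV f"
    by (intro continuous_at_imp_continuous_on) (auto intro: has_derivative_continuous[OF f])
  then have [measurable]: "f \<in> borel_measurable borel"
    by (rule borel_measurable_continuous_onI)
  have [measurable]: "(\<lambda>x. f' x v) \<in> borel_measurable borel"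
    by (rule borel_measurable_continuous_onI[OF f'])
  have intf: "integrable lborel f"
    by (rule integrable_continuous_compact_support[OF contf R])
  have op: "open {x::'a. norm x > R}"
    by (intro open_Collect_less continuous_intros)
  have z: "f' x v = 0" if "norm x > R" for x
    by (rule derivative_zero_if_locally_zero[OF f op]) (simp_all add: that R)
  obtain M where M: "M \<ge> 0" "\<And>x. \<bar>f' x v\<bar> \<le> M"
    using bounded_continuous_compact_support[OF f', of R] z by blast
  have eq: "(\<integral>x. (indicator A (x - step n *\<^sub>R v) - indicator A x) * f x \<partial>lborel) / step n
      = (\<integral>x. indicator A x * ((f (x + step n *\<^sub>R v) - f x) / step n) \<partial>lborel)" for n
  proof -
    have i1: "integrable lborel (\<lambda>x. indicator A x * f (x + step n *\<^sub>R v))"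
      by (intro integrable_indicator_mult lborel_integrable_translate intf) auto
    have i2: "integrable lborel (\<lambda>x. indicator A x * f x)"
      by (intro integrable_indicator_mult intf) auto
    have i3: "integrable lborel (\<lambda>x. indicator A (x - step n *\<^sub>R v) * f x)"
      using lborel_integrable_translate[OF i1, of "- step n *\<^sub>R v"] by simp
    have "(\<integral>x. indicator A (x - step n *\<^sub>R v) * f x \<partial>lborel)
        = (\<integral>x. indicator A (x + step n *\<^sub>R v - step n *\<^sub>R v) * f (x + step n *\<^sub>R v) \<partial>lborel)"
      by (subst lborel_integral_translate[of "\<lambda>x. indicator A (x - step n *\<^sub>R v) * f x" "step n *\<^sub>R v"]) auto
    then have "(\<integral>x. (indicator A (x - step n *\<^sub>R v) - indicator A x) * f x \<partial>lborel)
        = (\<integral>x. indicator A x * (f (x + step n *\<^sub>R v) - f x) \<partial>lborel)"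
      using i1 i2 i3 by (simp add: left_diff_distrib right_diff_distrib)
    then show ?thesis
      by (simp flip: Bochner_Integration.integral_divide_zero)
  qed
  have "(\<lambda>n. \<integral>x. indicator A x * ((f (x + step n *\<^sub>R v) - f x) / step n) \<partial>lborel)
           \<longlonglongrightarrow> (\<integral>x. indicator A x * f' x v \<partial>lborel)"
  proof (rule integral_dominated_convergence[where w = "\<lambda>x. indicator (cball 0 (\<bar>R\<bar> + norm v)) x *\<^sub>R M"])
    show "integrable lborel (\<lambda>x. indicator (cball 0 (\<bar>R\<bar> + norm v)) x *\<^sub>R M)"
      by (rule borel_integrable_compact) auto
    show "AE x in lborel. (\<lambda>n. indicator A x * ((f (x + step n *\<^sub>R v) - f x) / step n))
             \<longlonglongrightarrow> indicator A x * f' x v"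
    proof (intro AE_I2 tendsto_mult_left)
      fix x
      have "(f has_derivative f' x) (at (x + 0 *\<^sub>R v))"
        using f by simp
      from difference_quotient_tendsto[OF has_real_derivative_along_line[OF this]]
      show "(\<lambda>n. (f (x + step n *\<^sub>R v) - f x) / step n) \<longlonglongrightarrow> f' x v"
        by simp
    qed
    show "AE x in lborel. norm (indicator A x * ((f (x + step n *\<^sub>R v) - f x) / step n))
           \<le> indicator (cball 0 (\<bar>R\<bar> + norm v)) x *\<^sub>R M" for n
    proof (intro AE_I2)
      fix x
      have b: "\<bar>(f (x + step n *\<^sub>R v) - f x) / step n\<bar> \<le> M"
        using difference_along_line_bound[OF f M(2) step_pos, of x n] step_pos[of n]
        by (simp add: abs_divide field_simps)
      show "norm (indicator A x * ((f (x + step n *\<^sub>R v) - f x) / step n))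
           \<le> indicator (cball 0 (\<bar>R\<bar> + norm v)) x *\<^sub>R M"
      proof (cases "norm x \<le> \<bar>R\<bar> + norm v")
        case True
        then show ?thesis
          using b M(1) by (auto simp: indicator_def)
      next
        case False
        have "norm x \<le> norm (x + step n *\<^sub>R v) + norm (step n *\<^sub>R v)"
          using norm_triangle_ineq4[of "x + step n *\<^sub>R v" "step n *\<^sub>R v"] by simp
        moreover have "norm (step n *\<^sub>R v) \<le> norm v"
          using step_pos[of n] step_le_1[of n] by (simp add: mult_left_le_one_le)
        ultimately have "norm (x + step n *\<^sub>R v) > R" "norm x > R"
          using False norm_ge_zero[of v] by linarith+
        then show ?thesis
          using R M(1) by (simp add: indicator_def)
      qed
    qed
  qed auto
  then show ?thesis
    unfolding eq .
qed

text \<open>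
  The same quotient, computed from the set. On the line through \<open>x\<close> in direction \<open>e\<close> the region
  below the graph and its translate by \<open>hv\<close> are the half-lines below the heights \<open>a x 0\<close> and
  \<open>a x h\<close>, so the inner integral is a difference of values of an antiderivative \<open>\<Psi> x\<close> of \<open>f\<close>
  along the line. The chain rule at \<open>h = 0\<close> yields the value of \<open>f\<close> on the graph times the rate
  \<open>v \<bullet> (e - grad \<gamma> x)\<close> at which the graph sweeps through the line. The Lipschitz bound on \<open>\<gamma>\<close>
  dominates the quotients, and the chain rule applies on almost every line.
\<close>
lemma shifted_slab_tendsto:
  fixes f :: "real^'k \<Rightarrow> real"
  assumes e: "norm e = 1"
    and inv: "\<And>x s. \<gamma> (x + s *\<^sub>R e) = \<gamma> x"
    and lip: "L-lipschitz_on UNIV \<gamma>"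
    and diff: "AE x in lborel. \<gamma> differentiable (at x)"
    and contf: "continuous_on UNIV f"
    and R: "\<And>x. norm x > R \<Longrightarrow> f x = 0"
  defines "S \<equiv> {x. 0 \<le> x \<bullet> e \<and> x \<bullet> e \<le> 1}"
    and "A \<equiv> {x. x \<bullet> e < \<gamma> x}"
  shows "(\<lambda>n. (\<integral>x. (indicator A (x - step n *\<^sub>R v) - indicator A x) * f x \<partial>lborel) / step n)
           \<longlonglongrightarrow> (\<integral>x. indicator S x * (f (graph_point e \<gamma> x) * (v \<bullet> (e - limit_grad \<gamma> x))) \<partial>lborel)" (is ?lim)
    and "integrable lborel (\<lambda>x. indicator S x * (f (graph_point e \<gamma> x) * (v \<bullet> (e - limit_grad \<gamma> x))))" (is ?int)
proof -
  have [measurable]: "f \<in> borel_measurable borel"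
    by (rule borel_measurable_continuous_onI[OF contf])
  have cont\<gamma>: "continuous_on UNIV \<gamma>"
    by (rule lipschitz_on_continuous_on[OF lip])
  have [measurable]: "\<gamma> \<in> borel_measurable borel"
    by (rule borel_measurable_continuous_onI[OF cont\<gamma>])
  note [measurable] = measurable_limit_grad[OF cont\<gamma>] graph_point_measurable[OF cont\<gamma>]
  have A[measurable]: "A \<in> sets borel"
    unfolding A_def by measurable
  have S[measurable]: "S \<in> sets borel"
    unfolding S_def by measurable
  have ee: "e \<bullet> e = 1"
    using e by (simp add: dot_square_norm)
  have L: "L \<ge> 0"
    using lip by (rule lipschitz_on_nonneg)
  have intf: "integrable lborel f"
    by (rule integrable_continuous_compact_support[OF contf R])
  obtain M where M: "M \<ge> 0" "\<And>x. \<bar>f x\<bar> \<le> M"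
    using bounded_continuous_compact_support[OF contf, of R] R by blast
  define \<Psi> where "\<Psi> x a = (\<integral>s. indicator {..<a} s * f (x + s *\<^sub>R e) \<partial>lborel)" for x and a :: real
  define a where "a x h = \<gamma> (x - h *\<^sub>R v) + h * (v \<bullet> e) - x \<bullet> e" for x h
  have contl: "continuous_on UNIV (\<lambda>s. f (x + s *\<^sub>R e))" for x
    by (rule continuous_on_compose2[OF contf]) (auto intro!: continuous_intros)
  have far: "f (x + s *\<^sub>R e) = 0" if "\<bar>s\<bar> > R + norm x" for x s
  proof (rule R)
    have "norm (s *\<^sub>R e) \<le> norm (x + s *\<^sub>R e) + norm x"
      using norm_triangle_ineq4[of "x + s *\<^sub>R e" x] by simp
    then show "norm (x + s *\<^sub>R e) > R"
      using that e by simp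
  qed
  have d\<Psi>: "(\<Psi> x has_real_derivative f (x + b *\<^sub>R e)) (at b)" for x b
    unfolding \<Psi>_def by (rule has_real_derivative_integral_lessThan[OF contl far])
  have \<Psi>_lip: "\<bar>\<Psi> x b - \<Psi> x c\<bar> \<le> M * \<bar>b - c\<bar>" for x b c
    using field_differentiable_bound[of UNIV "\<Psi> x" "\<lambda>b. f (x + b *\<^sub>R e)" M b c] d\<Psi> M(2)
    by auto
  have inti: "integrable lborel (\<lambda>s. indicator {..<b} s * f (x + s *\<^sub>R e))" for x b
    by (intro integrable_indicator_mult integrable_continuous_compact_support[OF contl])
       (use far in auto)
  have slice: "(\<integral>s. (indicator A (x + s *\<^sub>R e - h *\<^sub>R v) - indicator A (x + s *\<^sub>R e)) * f (x + s *\<^sub>R e) \<partial>lborel)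
       = \<Psi> x (a x h) - \<Psi> x (a x 0)" for x h
  proof -
    have 1: "x + s *\<^sub>R e - h *\<^sub>R v \<in> A \<longleftrightarrow> s < a x h" for s
      using inv[of "x - h *\<^sub>R v" s] ee
      by (auto simp: A_def a_def inner_diff_left inner_add_left algebra_simps)
    have 2: "x + s *\<^sub>R e \<in> A \<longleftrightarrow> s < a x 0" for s
      using inv[of "x" s] ee
      by (auto simp: A_def a_def inner_diff_left inner_add_left algebra_simps)
    have "(\<integral>s. (indicator A (x + s *\<^sub>R e - h *\<^sub>R v) - indicator A (x + s *\<^sub>R e)) * f (x + s *\<^sub>R e) \<partial>lborel)
       = (\<integral>s. indicator {..<a x h} s * f (x + s *\<^sub>R e) - indicator {..<a x 0} s * f (x + s *\<^sub>R e) \<partial>lborel)"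
      by (intro Bochner_Integration.integral_cong refl) (simp add: indicator_def 1 2 left_diff_distrib)
    then show ?thesis
      unfolding \<Psi>_def using inti by simp
  qed
  define q where "q n x = indicator S x * ((\<Psi> x (a x (step n)) - \<Psi> x (a x 0)) / step n)" for n x
  have intq0: "integrable lborel (\<lambda>x. (indicator A (x - step n *\<^sub>R v) - indicator A x) * f x)" for n
  proof -
    have "integrable lborel (\<lambda>x. indicator {x. x - step n *\<^sub>R v \<in> A} x * f x)"
      by (intro integrable_indicator_mult intf) auto
    moreover have "integrable lborel (\<lambda>x. indicator A x * f x)"
      by (intro integrable_indicator_mult intf) auto
    ultimately have "integrable lborel (\<lambda>x. indicator {x. x - step n *\<^sub>R v \<in> A} x * f x - indicator A x * f x)"
      by (rule Bochner_Integration.integrable_diff)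
    then show ?thesis
      by (simp add: left_diff_distrib indicator_def)
  qed
  have intq: "integrable lborel (q n)" for n
    using integrable_divide[OF slab_Fubini(2)[OF e intq0[of n]], of "step n"]
    unfolding slice q_def S_def by simp
  have eq: "(\<integral>x. (indicator A (x - step n *\<^sub>R v) - indicator A x) * f x \<partial>lborel) / step n = (\<integral>x. q n x \<partial>lborel)" for n
    unfolding slab_Fubini(1)[OF e intq0[of n]] slice q_def S_def
    by (subst Bochner_Integration.integral_divide_zero[symmetric]) simp
  have lim: "AE x in lborel. (\<lambda>n. q n x) \<longlonglongrightarrow> indicator S x * (f (graph_point e \<gamma> x) * (v \<bullet> (e - limit_grad \<gamma> x)))"
    using diff
  proof eventually_elim
    fix x assume d: "\<gamma> differentiable (at x)"
    then have "(\<gamma> has_derivative frechet_derivative \<gamma> (at x)) (at (x + 0 *\<^sub>R (- v)))"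
      by (simp add: frechet_derivative_works)
    from has_real_derivative_along_line[OF this]
    have "((\<lambda>h. \<gamma> (x - h *\<^sub>R v)) has_real_derivative (- v) \<bullet> grad \<gamma> x) (at 0)"
      by (simp add: frechet_derivative_eq_inner_grad[OF d])
    then have da: "(a x has_real_derivative v \<bullet> (e - limit_grad \<gamma> x)) (at 0)"
      unfolding a_def limit_grad_eq_grad[OF d]
      by (auto intro!: derivative_eq_intros simp: inner_diff_right)
    have a0: "x + a x 0 *\<^sub>R e = graph_point e \<gamma> x"
      by (simp add: a_def graph_point_def)
    have "((\<lambda>h. \<Psi> x (a x h)) has_real_derivative f (graph_point e \<gamma> x) * (v \<bullet> (e - limit_grad \<gamma> x))) (at 0)"
      by (rule DERIV_chain2[OF d\<Psi>[of x "a x 0"] da, unfolded a0])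
    from difference_quotient_tendsto[OF this]
    show "(\<lambda>n. q n x) \<longlonglongrightarrow> indicator S x * (f (graph_point e \<gamma> x) * (v \<bullet> (e - limit_grad \<gamma> x)))"
      unfolding q_def by (rule tendsto_mult_left)
  qed
  define K where "K = M * (L * norm v + norm v)"
  have K: "K \<ge> 0"
    using M(1) L by (simp add: K_def)
  have bound: "AE x in lborel. norm (q n x) \<le> indicator (cball 0 (\<bar>R\<bar> + 1)) x *\<^sub>R K" for n
  proof (intro AE_I2)
    fix x
    show "norm (q n x) \<le> indicator (cball 0 (\<bar>R\<bar> + 1)) x *\<^sub>R K"
    proof (cases "x \<in> S")
      case False
      then show ?thesis using K by (simp add: q_def)
    next
      case xS: True
      show ?thesis
      proof (cases "norm x \<le> \<bar>R\<bar> + 1")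
        case True
        have "\<bar>\<gamma> (x - step n *\<^sub>R v) - \<gamma> x\<bar> \<le> L * (step n * norm v)"
          using lipschitz_onD[OF lip, of "x - step n *\<^sub>R v" x] step_pos[of n] by (simp add: dist_norm)
        moreover have "\<bar>step n * (v \<bullet> e)\<bar> \<le> step n * norm v"
          using Cauchy_Schwarz_ineq2[of v e] e step_pos[of n] by (simp add: abs_mult)
        ultimately have "\<bar>a x (step n) - a x 0\<bar> \<le> L * (step n * norm v) + step n * norm v"
          unfolding a_def by (simp add: abs_le_iff)
        also have "\<dots> = step n * (L * norm v + norm v)"
          by (simp add: algebra_simps)
        finally have "M * \<bar>a x (step n) - a x 0\<bar> \<le> M * (step n * (L * norm v + norm v))"
          using M(1) by (rule mult_left_mono)
        then have "\<bar>\<Psi> x (a x (step n)) - \<Psi> x (a x 0)\<bar> \<le> step n * K"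
          using \<Psi>_lip[of x "a x (step n)" "a x 0"] by (simp add: K_def mult_ac)
        then show ?thesis
          using True xS step_pos[of n] by (simp add: q_def abs_divide field_simps)
      next
        case False
        \<comment> \<open>The component \<open>?y\<close> of \<open>x\<close> orthogonal to \<open>e\<close> is the same along the whole line, and in the
        slab it differs from \<open>x\<close> by at most one; hence the whole line misses the support.\<close>
        have "f (x + s *\<^sub>R e) = 0" for s
        proof (rule R)
          let ?y = "x - (x \<bullet> e) *\<^sub>R e"
          have "norm x \<le> norm ?y + norm ((x \<bullet> e) *\<^sub>R e)"
            using norm_triangle_ineq[of ?y "(x \<bullet> e) *\<^sub>R e"] by simp
          moreover have "norm ((x \<bullet> e) *\<^sub>R e) \<le> 1"
            using xS e by (auto simp: S_def)
          moreover have "norm ?y \<le> norm (x + s *\<^sub>R e)"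
          proof -
            have dec: "x + s *\<^sub>R e = ?y + (s + x \<bullet> e) *\<^sub>R e"
              by (simp add: algebra_simps)
            have "orthogonal ?y ((s + x \<bullet> e) *\<^sub>R e)"
              using ee by (simp add: orthogonal_def inner_diff_left)
            from norm_add_Pythagorean[OF this]
            have "(norm ?y)\<^sup>2 \<le> (norm (x + s *\<^sub>R e))\<^sup>2"
              unfolding dec[symmetric] by simp
            then show ?thesis
              by (rule power2_le_imp_le) simp
          qed
          ultimately show "norm (x + s *\<^sub>R e) > R"
            using False by linarith
        qed
        then have "\<Psi> x b = 0" for b
          by (simp add: \<Psi>_def)
        then show ?thesis
          using K by (simp add: q_def)
      qed
    qed
  qed
  have w: "integrable lborel (\<lambda>x::real^'k. indicator (cball 0 (\<bar>R\<bar> + 1)) x *\<^sub>R K)"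
    by (rule borel_integrable_compact) auto
  have m1: "(\<lambda>x. indicator S x * (f (graph_point e \<gamma> x) * (v \<bullet> (e - limit_grad \<gamma> x)))) \<in> borel_measurable lborel"
    by measurable
  have m2: "q n \<in> borel_measurable lborel" for n
    using intq by auto
  show ?lim
    unfolding eq by (rule integral_dominated_convergence[OF m1 m2 w lim bound])
  show ?int
    by (rule integrable_dominated_convergence[OF m1 m2 w lim bound])
qed

text \<open>
  The two limits of the quotient agree. Formally this is the divergence theorem for the constant
  direction \<open>v\<close>, since \<open>e - grad \<gamma>\<close> is the unnormalised outward normal of the region below the
  graph.
\<close>
lemma undergraph_Gauss:
  fixes f :: "real^'k \<Rightarrow> real"
  assumes e: "norm e = 1"
    and inv: "\<And>x s. \<gamma> (x + s *\<^sub>R e) = \<gamma> x"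
    and lip: "L-lipschitz_on UNIV \<gamma>"
    and diff: "AE x in lborel. \<gamma> differentiable (at x)"
    and f: "\<And>x. (f has_derivative f' x) (at x)"
    and f': "continuous_on UNIV (\<lambda>x. f' x v)"
    and R: "\<And>x. norm x > R \<Longrightarrow> f x = 0"
  shows "(\<integral>x. indicator {x. x \<bullet> e < \<gamma> x} x * f' x v \<partial>lborel)
       = (\<integral>x. indicator {x. 0 \<le> x \<bullet> e \<and> x \<bullet> e \<le> 1} x * (f (graph_point e \<gamma> x) * (v \<bullet> (e - limit_grad \<gamma> x))) \<partial>lborel)"
proof -
  have [measurable]: "\<gamma> \<in> borel_measurable borel"
    by (rule borel_measurable_continuous_onI[OF lipschitz_on_continuous_on[OF lip]])
  let ?A = "{x. x \<bullet> e < \<gamma> x}"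
  have contf: "continuous_on UNIV f"
    by (intro continuous_at_imp_continuous_on) (auto intro: has_derivative_continuous[OF f])
  have "(\<lambda>n. (\<integral>x. (indicator ?A (x - step n *\<^sub>R v) - indicator ?A x) * f x \<partial>lborel) / step n)
           \<longlonglongrightarrow> (\<integral>x. indicator ?A x * f' x v \<partial>lborel)"
    by (rule shifted_volume_tendsto[where R = R, OF f f']) (simp_all add: R)
  moreover have "(\<lambda>n. (\<integral>x. (indicator ?A (x - step n *\<^sub>R v) - indicator ?A x) * f x \<partial>lborel) / step n)
           \<longlonglongrightarrow> (\<integral>x. indicator {x. 0 \<le> x \<bullet> e \<and> x \<bullet> e \<le> 1} x
                 * (f (graph_point e \<gamma> x) * (v \<bullet> (e - limit_grad \<gamma> x))) \<partial>lborel)"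
    by (rule shifted_slab_tendsto(1)[where R = R, OF e inv lip diff contf]) (simp_all add: R)
  ultimately show ?thesis
    by (rule LIMSEQ_unique)
qed

section \<open>Continuously differentiable functions\<close>

definition C1_on :: "'a::euclidean_space set \<Rightarrow> ('a \<Rightarrow> 'b::real_normed_vector) \<Rightarrow> bool" where
  "C1_on S f \<longleftrightarrow> (\<forall>x\<in>S. f differentiable (at x)) \<and>
     (\<forall>v. continuous_on S (\<lambda>x. frechet_derivative f (at x) v))"

lemma C1_onI:
  assumes "\<And>x. x \<in> S \<Longrightarrow> (f has_derivative f' x) (at x)"
    and "\<And>v. continuous_on S (\<lambda>x. f' x v)"
  shows "C1_on S f"
proof -
  have "frechet_derivative f (at x) v = f' x v" if "x \<in> S" for x v
    using frechet_derivative_at[OF assms(1)[OF that]] by simp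
  then have "continuous_on S (\<lambda>x. frechet_derivative f (at x) v)" for v
    using assms(2)[of v] by (simp cong: continuous_on_cong)
  then show ?thesis
    using assms(1) by (auto simp: C1_on_def differentiable_def)
qed

lemma C1_on_derivative:
  assumes "C1_on S f" "x \<in> S"
  shows "(f has_derivative frechet_derivative f (at x)) (at x)"
  using assms by (auto simp: C1_on_def frechet_derivative_works)

lemma C1_on_continuous_derivative:
  "C1_on S f \<Longrightarrow> continuous_on S (\<lambda>x. frechet_derivative f (at x) v)"
  by (auto simp: C1_on_def)

lemma C1_on_imp_continuous_on:
  assumes "C1_on S f"
  shows "continuous_on S f"
  by (intro continuous_at_imp_continuous_on ballI has_derivative_continuous[OF C1_on_derivative[OF assms]])

lemma C1_on_subset: "C1_on S f \<Longrightarrow> T \<subseteq> S \<Longrightarrow> C1_on T f"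
  by (auto simp: C1_on_def intro: continuous_on_subset)

lemma C1_on_const: "C1_on S (\<lambda>_. c)"
  by (rule C1_onI[where f' = "\<lambda>_ _. 0"]) (auto intro!: derivative_eq_intros)

lemma C1_on_add:
  assumes "C1_on S f" "C1_on S g"
  shows "C1_on S (\<lambda>x. f x + g x)"
  by (rule C1_onI[where f' = "\<lambda>x v. frechet_derivative f (at x) v + frechet_derivative g (at x) v"])
     (auto intro!: has_derivative_add continuous_on_add C1_on_derivative C1_on_continuous_derivative assms)

lemma C1_on_diff:
  assumes "C1_on S f" "C1_on S g"
  shows "C1_on S (\<lambda>x. f x - g x)"
  by (rule C1_onI[where f' = "\<lambda>x v. frechet_derivative f (at x) v - frechet_derivative g (at x) v"])
     (auto intro!: has_derivative_diff continuous_on_diff C1_on_derivative C1_on_continuous_derivative assms)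

lemma C1_on_sum:
  assumes "\<And>i. i \<in> I \<Longrightarrow> C1_on S (f i)"
  shows "C1_on S (\<lambda>x. \<Sum>i\<in>I. f i x)"
proof (cases "finite I")
  case True
  from this assms show ?thesis
    by (induction I) (auto intro!: C1_on_const C1_on_add)
qed (simp add: C1_on_const)

lemma C1_on_bounded_linear:
  assumes "bounded_linear h" "C1_on S f"
  shows "C1_on S (\<lambda>x. h (f x))"
  by (rule C1_onI[where f' = "\<lambda>x v. h (frechet_derivative f (at x) v)"])
     (auto intro!: bounded_linear.has_derivative[OF assms(1)] bounded_linear.continuous_on[OF assms(1)]
        C1_on_derivative C1_on_continuous_derivative assms)

lemma C1_on_bounded_bilinear:
  assumes "bounded_bilinear h" "C1_on S f" "C1_on S g"
  shows "C1_on S (\<lambda>x. h (f x) (g x))"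
proof (rule C1_onI)
  show "((\<lambda>x. h (f x) (g x)) has_derivative
      (\<lambda>v. h (f x) (frechet_derivative g (at x) v) + h (frechet_derivative f (at x) v) (g x))) (at x)"
    if "x \<in> S" for x
    by (rule bounded_bilinear.FDERIV[OF assms(1) C1_on_derivative[OF assms(2) that] C1_on_derivative[OF assms(3) that]])
  show "continuous_on S (\<lambda>x. h (f x) (frechet_derivative g (at x) v) + h (frechet_derivative f (at x) v) (g x))" for v
    by (intro continuous_on_add bounded_bilinear.continuous_on[OF assms(1)]
        C1_on_imp_continuous_on[OF assms(2)] C1_on_imp_continuous_on[OF assms(3)]
        C1_on_continuous_derivative[OF assms(2)] C1_on_continuous_derivative[OF assms(3)])
qed

lemma C1_on_mult:
  fixes f g :: "'a::euclidean_space \<Rightarrow> real"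
  shows "C1_on S f \<Longrightarrow> C1_on S g \<Longrightarrow> C1_on S (\<lambda>x. f x * g x)"
  by (rule C1_on_bounded_bilinear[OF bounded_bilinear_mult])

lemma C1_on_prod:
  fixes f :: "'i \<Rightarrow> 'a::euclidean_space \<Rightarrow> real"
  assumes "\<And>i. i \<in> I \<Longrightarrow> C1_on S (f i)"
  shows "C1_on S (\<lambda>x. \<Prod>i\<in>I. f i x)"
proof (cases "finite I")
  case True
  from this assms show ?thesis
    by (induction I) (auto intro!: C1_on_const C1_on_mult)
qed (simp add: C1_on_const)

text \<open>
  The derivative of \<open>g\<close> at \<open>f x\<close> is applied to a vector that itself depends on \<open>x\<close>. Expanding this
  vector in the standard basis reduces continuity to fixed directions, which is all that
  \<open>C1_on\<close> provides.
\<close>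
lemma C1_on_compose:
  fixes f :: "'a::euclidean_space \<Rightarrow> 'b::euclidean_space"
  assumes f: "C1_on S f" and g: "C1_on T g" and "f ` S \<subseteq> T"
  shows "C1_on S (\<lambda>x. g (f x))"
proof (rule C1_onI)
  fix x assume x: "x \<in> S"
  show "((\<lambda>x. g (f x)) has_derivative (\<lambda>v. frechet_derivative g (at (f x)) (frechet_derivative f (at x) v))) (at x)"
    using assms(3) x by (intro has_derivative_compose[OF C1_on_derivative[OF f] C1_on_derivative[OF g]]) auto
next
  fix v
  have "frechet_derivative g (at (f x)) (frechet_derivative f (at x) v)
     = (\<Sum>b\<in>Basis. (frechet_derivative f (at x) v \<bullet> b) *\<^sub>R frechet_derivative g (at (f x)) b)" if "x \<in> S" for x
  proof -
    have lin: "linear (frechet_derivative g (at (f x)))"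
      by (rule has_derivative_linear[OF C1_on_derivative[OF g]]) (use assms(3) that in auto)
    show ?thesis
      by (subst euclidean_representation[symmetric, of "frechet_derivative f (at x) v"])
         (simp only: linear_sum[OF lin] linear_cmul[OF lin])
  qed
  moreover have "continuous_on S (\<lambda>x. \<Sum>b\<in>Basis. (frechet_derivative f (at x) v \<bullet> b) *\<^sub>R frechet_derivative g (at (f x)) b)"
    by (intro continuous_intros C1_on_continuous_derivative[OF f]
          continuous_on_compose2[OF C1_on_continuous_derivative[OF g] C1_on_imp_continuous_on[OF f] assms(3)])
  ultimately show "continuous_on S (\<lambda>x. frechet_derivative g (at (f x)) (frechet_derivative f (at x) v))"
    by (simp cong: continuous_on_cong)
qed

lemma C1_on_Un:
  assumes "open S" "open T" "C1_on S f" "C1_on T f"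
  shows "C1_on (S \<union> T) f"
  using assms by (auto simp: C1_on_def intro!: continuous_on_open_Un)

lemma C1_on_cong_open:
  assumes "open S" "C1_on S f" "\<And>x. x \<in> S \<Longrightarrow> f x = g x"
  shows "C1_on S g"
proof (rule C1_onI[where f' = "\<lambda>x. frechet_derivative f (at x)"])
  show "(g has_derivative frechet_derivative f (at x)) (at x)" if "x \<in> S" for x
    by (rule has_derivative_transform_within_open[OF C1_on_derivative[OF assms(2) that] assms(1) that assms(3)])
qed (rule C1_on_continuous_derivative[OF assms(2)])

lemma C1_on_square_positive_part: "C1_on UNIV (\<lambda>t::real. (max 0 t)\<^sup>2)"
proof (rule C1_onI)
  fix t :: real
  have "((\<lambda>t. (max 0 t)\<^sup>2) has_real_derivative 2 * max 0 t) (at t)"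
  proof (cases t "0 :: real" rule: linorder_cases)
    case less
    have "((\<lambda>_::real. 0::real) has_real_derivative 0) (at t)"
      by simp
    then have "((\<lambda>t. (max 0 t)\<^sup>2) has_real_derivative 0) (at t)"
      by (rule has_field_derivative_transform_within_open[where S = "{..<0}"]) (use less in auto)
    with less show ?thesis by simp
  next
    case equal
    have "((\<lambda>h. ((max 0 (0 + h))\<^sup>2 - (max 0 0)\<^sup>2) / h) \<longlongrightarrow> (0::real)) (at 0)"
    proof (rule tendsto_rabs_zero_cancel, rule tendsto_sandwich)
      show "\<forall>\<^sub>F h::real in at 0. 0 \<le> \<bar>((max 0 (0 + h))\<^sup>2 - (max 0 0)\<^sup>2) / h\<bar>"
        by simp
      show "\<forall>\<^sub>F h::real in at 0. \<bar>((max 0 (0 + h))\<^sup>2 - (max 0 0)\<^sup>2) / h\<bar> \<le> \<bar>h\<bar>"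
        by (intro always_eventually) (auto simp: max_def power2_eq_square)
      show "((\<lambda>h::real. \<bar>h\<bar>) \<longlongrightarrow> 0) (at 0)"
        by (auto intro!: tendsto_eq_intros)
    qed auto
    then show ?thesis
      using equal by (simp add: DERIV_def)
  next
    case greater
    have "((\<lambda>t::real. t\<^sup>2) has_real_derivative 2 * t) (at t)"
      by (auto intro!: derivative_eq_intros)
    then have "((\<lambda>t. (max 0 t)\<^sup>2) has_real_derivative 2 * t) (at t)"
      by (rule has_field_derivative_transform_within_open[where S = "{0<..}"]) (use greater in auto)
    with greater show ?thesis by simp
  qed
  then show "((\<lambda>t. (max 0 t)\<^sup>2) has_derivative (*) (2 * max 0 t)) (at t)"
    by (simp add: has_field_derivative_def)
qed (auto intro!: continuous_intros)

text \<open>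
  The square of the positive part is continuously differentiable. Applied to
  \<open>1 - \<bar>x - p\<bar>\<^sup>2 / r\<^sup>2\<close> it gives a bump that vanishes off the ball and is at least
  \<open>(3/4)\<^sup>2 > 1/2\<close> on the ball of half the radius; applied once more, upside down, it flattens
  all values above \<open>1/2\<close> to the plateau \<open>1\<close>.
\<close>
lemma C1_cutoff:
  fixes p :: "'a::euclidean_space"
  assumes "r > 0"
  shows "\<exists>c. C1_on UNIV c \<and> (\<forall>x. dist p x \<le> r / 2 \<longrightarrow> c x = (1::real)) \<and> (\<forall>x. dist p x \<ge> r \<longrightarrow> c x = 0)"
proof -
  let ?q = "\<lambda>t::real. (max 0 t)\<^sup>2"
  define k where "k = 1 / r\<^sup>2"
  let ?d = "\<lambda>x. 1 - k * ((x - p) \<bullet> (x - p))"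
  let ?c = "\<lambda>x. 1 - ?q (1 - 2 * ?q (?d x))"
  have "C1_on UNIV ?d"
    by (rule C1_onI[where f' = "\<lambda>x v. - (k * (2 * (v \<bullet> (x - p))))"])
       (auto intro!: derivative_eq_intros continuous_intros simp: fun_eq_iff inner_commute)
  from C1_on_compose[OF this C1_on_square_positive_part]
  have "C1_on UNIV (\<lambda>x. 1 - 2 * ?q (?d x))"
    by (intro C1_on_diff C1_on_mult C1_on_const) auto
  from C1_on_compose[OF this C1_on_square_positive_part]
  have C: "C1_on UNIV ?c"
    by (intro C1_on_diff C1_on_const) auto
  have dd: "?d x = 1 - (dist p x / r)\<^sup>2" for x
    by (simp add: k_def dist_norm norm_minus_commute power_divide dot_square_norm)
  have c1: "?c x = 1" if "dist p x \<le> r / 2" for x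
  proof -
    have "(dist p x / r)\<^sup>2 \<le> (1/2)\<^sup>2"
      using that assms by (intro power_mono) (auto simp: field_simps)
    then have "?d x \<ge> 3/4"
      unfolding dd by (simp add: power2_eq_square)
    then have "3/4 \<le> max 0 (?d x)"
      by (rule max.coboundedI2)
    from power_mono[OF this, of 2] have "1 - 2 * ?q (?d x) \<le> 0"
      by (simp add: power2_eq_square)
    then show ?thesis
      by (simp add: max_def)
  qed
  have c0: "?c x = 0" if "dist p x \<ge> r" for x
  proof -
    have "(dist p x / r)\<^sup>2 \<ge> 1\<^sup>2"
      using that assms by (intro power_mono) (auto simp: field_simps)
    then have "?d x \<le> 0"
      unfolding dd by simp
    then show ?thesis
      by (simp add: max_def)
  qed
  show ?thesis
    using C c1 c0 by (intro exI[of _ ?c]) blast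
qed

section \<open>Charts and surface measure\<close>

lemma chart_frontier:
  assumes "graph_chart \<Omega> W e \<gamma>" "open \<Omega>" "x \<in> W"
  shows "x \<in> frontier \<Omega> \<longleftrightarrow> x \<bullet> e = \<gamma> x"
proof -
  from assms(1) obtain L where W: "open W" and e: "norm e = 1" and inv: "\<And>x s. \<gamma> (x + s *\<^sub>R e) = \<gamma> x"
    and \<Omega>: "\<And>x. x \<in> W \<Longrightarrow> x \<in> \<Omega> \<longleftrightarrow> x \<bullet> e < \<gamma> x" and lip: "L-lipschitz_on UNIV \<gamma>"
    unfolding graph_chart_def by blast
  have ee: "e \<bullet> e = 1"
    using e by (simp add: dot_square_norm)
  have cont: "continuous_on UNIV \<gamma>"
    by (rule lipschitz_on_continuous_on[OF lip])
  have fr: "frontier \<Omega> = closure \<Omega> - \<Omega>"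
    using assms(2) by (simp add: frontier_def interior_open)
  have "x \<in> closure \<Omega>" if "x \<bullet> e = \<gamma> x"
    unfolding closure_approachable
  proof (intro allI impI)
    fix d :: real assume "d > 0"
    obtain r where r: "r > 0" "ball x r \<subseteq> W"
      using W assms(3) by (meson open_contains_ball)
    define s where "s = min d r / 2"
    have s: "s > 0" "s < d" "s < r"
      using \<open>d > 0\<close> r by (auto simp: s_def min_def)
    have "x - s *\<^sub>R e \<in> W"
      using r(2) s e by (auto simp: dist_norm)
    moreover have "(x - s *\<^sub>R e) \<bullet> e < \<gamma> (x - s *\<^sub>R e)"
      using that inv[of x "- s"] s ee by (simp add: inner_diff_left)
    ultimately have "x - s *\<^sub>R e \<in> \<Omega>"
      by (simp add: \<Omega>)
    then show "\<exists>y\<in>\<Omega>. dist y x < d"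
      using s e by (intro bexI[of _ "x - s *\<^sub>R e"]) (auto simp: dist_norm)
  qed
  moreover have "x \<notin> closure \<Omega>" if "x \<bullet> e > \<gamma> x"
  proof -
    have "open (W \<inter> {x. \<gamma> x < x \<bullet> e})"
      by (intro open_Int W open_Collect_less cont continuous_intros)
    moreover have "W \<inter> {x. \<gamma> x < x \<bullet> e} \<inter> \<Omega> = {}"
      using \<Omega> by force
    ultimately have "W \<inter> {x. \<gamma> x < x \<bullet> e} \<inter> closure \<Omega> = {}"
      by (simp add: open_Int_closure_eq_empty)
    then show ?thesis
      using that assms(3) by auto
  qed
  ultimately show ?thesis
    using \<Omega>[OF assms(3)] unfolding fr
    by (cases "x \<bullet> e" "\<gamma> x" rule: linorder_cases) auto
qed

text \<open>
  Near an interior point, a constant \<open>\<gamma>\<close> above the whole neighbourhood is a chart as well.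
  Boundary and interior points can then be treated alike: in such a chart the surface integral
  is empty.
\<close>
lemma closure_has_chart:
  fixes \<Omega> :: "(real^'k) set"
  assumes "lipschitz_domain \<Omega>" "p \<in> closure \<Omega>"
  shows "\<exists>W e \<gamma>. p \<in> W \<and> graph_chart \<Omega> W e \<gamma>"
proof (cases "p \<in> \<Omega>")
  case True
  with assms obtain r where r: "r > 0" "ball p r \<subseteq> \<Omega>"
    unfolding lipschitz_domain_def by (meson open_contains_ball)
  define e :: "real^'k" where "e = axis undefined 1"
  have e: "norm e = 1"
    by (simp add: e_def)
  have "x \<bullet> e < norm p + r" if "x \<in> ball p r" for x
  proof -
    have "x \<bullet> e \<le> norm x"
      using Cauchy_Schwarz_ineq2[of x e] e by simp
    also have "\<dots> \<le> norm p + norm (x - p)"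
      using norm_triangle_ineq[of p "x - p"] by simp
    also have "\<dots> < norm p + r"
      using that by (simp add: dist_norm norm_minus_commute)
    finally show ?thesis .
  qed
  then have "graph_chart \<Omega> (ball p r) e (\<lambda>_. norm p + r)"
    unfolding graph_chart_def using e r(2)
    by (auto intro!: exI[of _ 0] lipschitz_onI)
  then show ?thesis
    using r(1) by (intro exI[of _ "ball p r"]) auto
next
  case False
  with assms have "p \<in> frontier \<Omega>"
    by (auto simp: lipschitz_domain_def frontier_def interior_open)
  with assms(1) show ?thesis
    by (auto simp: lipschitz_domain_def)
qed

text \<open>
  The chart formula for the measure of sets, as an equality of measures: inside a chart, the
  surface measure is the image under the graph map of a measure on the slab with a density.
\<close>
lemma chart_surface_measure:
  fixes \<Omega> :: "(real^'k) set"
  assumes \<sigma>: "surface_measure \<Omega> \<sigma>" and chart: "graph_chart \<Omega> W e \<gamma>" and "open \<Omega>"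
  defines "S \<equiv> {x. 0 \<le> x \<bullet> e \<and> x \<bullet> e \<le> 1}"
  shows "density \<sigma> (indicator (frontier \<Omega> \<inter> W))
       = distr (density lborel (\<lambda>x. ennreal (indicator S x * indicator W (graph_point e \<gamma> x) * norm (e - limit_grad \<gamma> x))))
           borel (graph_point e \<gamma>)"
proof (rule measure_eqI)
  have sets_\<sigma>[simp]: "sets \<sigma> = sets borel"
    using \<sigma> by (simp add: surface_measure_def)
  then have sp[simp]: "space \<sigma> = UNIV"
    using sets_eq_imp_space_eq by fastforce
  from chart obtain L where W: "open W" and e: "norm e = 1" and inv: "\<And>x s. \<gamma> (x + s *\<^sub>R e) = \<gamma> x"
    and lip: "L-lipschitz_on UNIV \<gamma>" and diff: "AE x in lborel. \<gamma> differentiable (at x)"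
    unfolding graph_chart_def by blast
  have cont: "continuous_on UNIV \<gamma>"
    by (rule lipschitz_on_continuous_on[OF lip])
  note [measurable] = measurable_limit_grad[OF cont] graph_point_measurable[OF cont]
  have Wm[measurable]: "W \<in> sets borel"
    using W by auto
  have fm[measurable]: "frontier \<Omega> \<in> sets borel"
    by (intro borel_closed) simp
  have [measurable]: "S \<in> sets borel"
    unfolding S_def by measurable
  have ee: "e \<bullet> e = 1"
    using e by (simp add: dot_square_norm)
  have onfr: "graph_point e \<gamma> x \<in> frontier \<Omega>" if "graph_point e \<gamma> x \<in> W" for x
    unfolding chart_frontier[OF chart assms(3) that]
    using inv[of x "\<gamma> x - x \<bullet> e"] ee by (simp add: graph_point_def inner_add_left)
  show "sets (density \<sigma> (indicator (frontier \<Omega> \<inter> W)))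
     = sets (distr (density lborel (\<lambda>x. ennreal (indicator S x * indicator W (graph_point e \<gamma> x) * norm (e - limit_grad \<gamma> x))))
           borel (graph_point e \<gamma>))"
    by simp
  fix E assume "E \<in> sets (density \<sigma> (indicator (frontier \<Omega> \<inter> W)))"
  then have E[measurable]: "E \<in> sets borel"
    by simp
  let ?E = "E \<inter> (frontier \<Omega> \<inter> W)"
  have mE: "?E \<in> sets borel" and mF: "frontier \<Omega> \<inter> W \<in> sets borel"
    by measurable
  have "emeasure (density \<sigma> (indicator (frontier \<Omega> \<inter> W))) E
      = (\<integral>\<^sup>+ x. indicator (frontier \<Omega> \<inter> W) x * indicator E x \<partial>\<sigma>)"
    by (rule emeasure_density) (use mF in \<open>auto intro!: borel_measurable_indicator\<close>)
  also have "\<dots> = (\<integral>\<^sup>+ x. indicator ?E x \<partial>\<sigma>)"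
    by (intro nn_integral_cong) (auto simp: indicator_def)
  also have "\<dots> = emeasure \<sigma> ?E"
    using mE by (subst nn_integral_indicator) auto
  also have "\<dots> = (\<integral>\<^sup>+ x\<in>{x. 0 \<le> x \<bullet> e \<and> x \<bullet> e \<le> 1 \<and> graph_point e \<gamma> x \<in> ?E}.
               ennreal (norm (e - grad \<gamma> x)) \<partial>lborel)"
    by (rule \<sigma>[unfolded surface_measure_def, THEN conjunct2, rule_format, OF chart mE]) blast
  also have "\<dots> = (\<integral>\<^sup>+ x. ennreal (indicator S x * indicator W (graph_point e \<gamma> x) * norm (e - limit_grad \<gamma> x))
        * indicator E (graph_point e \<gamma> x) \<partial>lborel)"
  proof (rule nn_integral_cong_AE)
    show "AE x in lborel. ennreal (norm (e - grad \<gamma> x)) * indicator {x. 0 \<le> x \<bullet> e \<and> x \<bullet> e \<le> 1 \<and> graph_point e \<gamma> x \<in> ?E} x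
       = ennreal (indicator S x * indicator W (graph_point e \<gamma> x) * norm (e - limit_grad \<gamma> x)) * indicator E (graph_point e \<gamma> x)"
      using diff
    proof eventually_elim
      case (elim x)
      then show ?case
        using onfr[of x] by (auto simp: S_def indicator_def limit_grad_eq_grad)
    qed
  qed
  also have "\<dots> = (\<integral>\<^sup>+ x. ennreal (indicator S x * indicator W (graph_point e \<gamma> x) * norm (e - limit_grad \<gamma> x))
        * indicator (graph_point e \<gamma> -` E) x \<partial>lborel)"
    by (simp add: indicator_def)
  also have "\<dots> = emeasure (density lborel (\<lambda>x. ennreal (indicator S x * indicator W (graph_point e \<gamma> x) * norm (e - limit_grad \<gamma> x))))
        (graph_point e \<gamma> -` E)"
    using measurable_sets[OF graph_point_measurable[OF cont] E]
    by (subst emeasure_density) auto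
  also have "\<dots> = emeasure (distr (density lborel (\<lambda>x. ennreal (indicator S x * indicator W (graph_point e \<gamma> x) * norm (e - limit_grad \<gamma> x))))
           borel (graph_point e \<gamma>)) E"
    by (subst emeasure_distr) auto
  finally show "emeasure (density \<sigma> (indicator (frontier \<Omega> \<inter> W))) E = \<dots>" .
qed

lemma chart_surface_integral:
  fixes \<Omega> :: "(real^'k) set" and g :: "real^'k \<Rightarrow> real"
  assumes \<sigma>: "surface_measure \<Omega> \<sigma>" and chart: "graph_chart \<Omega> W e \<gamma>" and op: "open \<Omega>"
    and g[measurable]: "g \<in> borel_measurable borel"
  defines "S \<equiv> {x. 0 \<le> x \<bullet> e \<and> x \<bullet> e \<le> 1}"
  defines "\<rho> \<equiv> (\<lambda>x. indicator S x * indicator W (graph_point e \<gamma> x) * norm (e - limit_grad \<gamma> x))"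
  shows "(\<integral>x. indicator (frontier \<Omega> \<inter> W) x * g x \<partial>\<sigma>) = (\<integral>x. \<rho> x * g (graph_point e \<gamma> x) \<partial>lborel)"
    and "integrable \<sigma> (\<lambda>x. indicator (frontier \<Omega> \<inter> W) x * g x) \<longleftrightarrow> integrable lborel (\<lambda>x. \<rho> x * g (graph_point e \<gamma> x))"
proof -
  have sets_\<sigma>[simp, measurable_cong]: "sets \<sigma> = sets borel"
    using \<sigma> by (simp add: surface_measure_def)
  from chart obtain L where W: "open W" and lip: "L-lipschitz_on UNIV \<gamma>"
    unfolding graph_chart_def by blast
  have cont: "continuous_on UNIV \<gamma>"
    by (rule lipschitz_on_continuous_on[OF lip])
  note [measurable] = measurable_limit_grad[OF cont] graph_point_measurable[OF cont]
  have Wm[measurable]: "W \<in> sets borel"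
    using W by auto
  have [measurable]: "frontier \<Omega> \<in> sets borel"
    by (intro borel_closed) simp
  have [measurable]: "S \<in> sets borel"
    unfolding S_def by measurable
  have \<rho>[measurable]: "\<rho> \<in> borel_measurable lborel" and \<rho>0: "AE x in lborel. 0 \<le> \<rho> x"
    unfolding \<rho>_def by auto
  have i0: "AE x in \<sigma>. 0 \<le> (indicator (frontier \<Omega> \<inter> W) x :: real)"
    by simp
  have im: "(indicator (frontier \<Omega> \<inter> W) :: _ \<Rightarrow> real) \<in> borel_measurable \<sigma>"
    by measurable
  have gm: "g \<in> borel_measurable \<sigma>" by measurable
  have eq: "density \<sigma> (\<lambda>x. ennreal (indicator (frontier \<Omega> \<inter> W) x)) = distr (density lborel (\<lambda>x. ennreal (\<rho> x))) borel (graph_point e \<gamma>)"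
    using chart_surface_measure[OF \<sigma> chart op] by (simp add: \<rho>_def S_def ennreal_indicator)
  show "(\<integral>x. indicator (frontier \<Omega> \<inter> W) x * g x \<partial>\<sigma>) = (\<integral>x. \<rho> x * g (graph_point e \<gamma> x) \<partial>lborel)"
    using arg_cong[OF eq, of "\<lambda>M. integral\<^sup>L M g"]
    by (subst (asm) integral_density[OF gm im i0], subst (asm) integral_distr)
       (use \<rho>0 in \<open>auto simp: integral_density\<close>)
  have "integrable \<sigma> (\<lambda>x. indicator (frontier \<Omega> \<inter> W) x *\<^sub>R g x) \<longleftrightarrow>
     integrable (distr (density lborel (\<lambda>x. ennreal (\<rho> x))) borel (graph_point e \<gamma>)) g"
    by (subst integrable_density[OF gm im i0, symmetric], subst eq) (rule refl)
  also have "\<dots> \<longleftrightarrow> integrable lborel (\<lambda>x. \<rho> x *\<^sub>R g (graph_point e \<gamma> x))"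
    using \<rho>0 by (subst integrable_distr_eq) (auto simp: integrable_density)
  finally show "integrable \<sigma> (\<lambda>x. indicator (frontier \<Omega> \<inter> W) x * g x) \<longleftrightarrow> integrable lborel (\<lambda>x. \<rho> x * g (graph_point e \<gamma> x))"
    by simp
qed

section \<open>The divergence theorem on Lipschitz domains\<close>

text \<open>
  The divergence theorem for the vector field \<open>f v\<close> with constant direction \<open>v\<close>. Integrability is
  included because the integrals of non-integrable functions are zero by convention, and because
  it makes the identity additive in \<open>f\<close>.
\<close>
definition Gauss_identity ::
    "(real^'k) set \<Rightarrow> (real^'k) measure \<Rightarrow> (real^'k \<Rightarrow> real^'k) \<Rightarrow> real^'k \<Rightarrow> (real^'k \<Rightarrow> real) \<Rightarrow> bool" where
  "Gauss_identity \<Omega> \<sigma> \<nu> v f \<longleftrightarrow>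
     set_integrable lborel \<Omega> (\<lambda>x. frechet_derivative f (at x) v) \<and>
     set_integrable \<sigma> (frontier \<Omega>) (\<lambda>x. f x * (v \<bullet> \<nu> x)) \<and>
     (LINT x:\<Omega>|lborel. frechet_derivative f (at x) v) = (LINT x:frontier \<Omega>|\<sigma>. f x * (v \<bullet> \<nu> x))"

text \<open>
  For a function supported in one chart, both sides are the slab integral of \<open>undergraph_Gauss\<close>:
  the density \<open>norm (e - grad \<gamma>)\<close> of the surface measure cancels the normalisation of the unit
  normal. Where the graph leaves \<open>W\<close>, the support makes both integrands vanish.
\<close>
lemma Gauss_identity_local:
  fixes \<Omega> :: "(real^'k) set"
  assumes op: "open \<Omega>" and \<sigma>: "surface_measure \<Omega> \<sigma>" and \<nu>: "outward_unit_normal \<Omega> \<nu>"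
    and chart: "graph_chart \<Omega> W e \<gamma>" and pW: "cball p r \<subseteq> W"
    and f: "C1_on UNIV f" and f0: "\<And>x. x \<notin> cball p r \<Longrightarrow> f x = 0"
  shows "Gauss_identity \<Omega> \<sigma> \<nu> v f"
proof -
  from chart obtain L where W: "open W" and e: "norm e = 1" and inv: "\<And>x s. \<gamma> (x + s *\<^sub>R e) = \<gamma> x"
    and \<Omega>: "\<And>x. x \<in> W \<Longrightarrow> x \<in> \<Omega> \<longleftrightarrow> x \<bullet> e < \<gamma> x"
    and lip: "L-lipschitz_on UNIV \<gamma>" and diff: "AE x in lborel. \<gamma> differentiable (at x)"
    unfolding graph_chart_def by blast
  have sets_\<sigma>[simp, measurable_cong]: "sets \<sigma> = sets borel"
    using \<sigma> by (simp add: surface_measure_def)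
  have cont: "continuous_on UNIV \<gamma>"
    by (rule lipschitz_on_continuous_on[OF lip])
  note [measurable] = measurable_limit_grad[OF cont] graph_point_measurable[OF cont]
  have Wm[measurable]: "W \<in> sets borel"
    using W by auto
  have contf: "continuous_on UNIV f"
    by (rule C1_on_imp_continuous_on[OF f])
  then have fm[measurable]: "f \<in> borel_measurable borel"
    by (rule borel_measurable_continuous_onI)
  have \<nu>m[measurable]: "\<nu> \<in> borel_measurable borel"
    using \<nu> by (simp add: outward_unit_normal_def)
  let ?D = "\<lambda>x. frechet_derivative f (at x) v"
  let ?S = "{x. 0 \<le> x \<bullet> e \<and> x \<bullet> e \<le> 1}"
  let ?R = "norm p + \<bar>r\<bar>"
  have contD: "continuous_on UNIV ?D"
    by (rule C1_on_continuous_derivative[OF f])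
  have df: "(f has_derivative frechet_derivative f (at x)) (at x)" for x
    by (rule C1_on_derivative[OF f]) simp
  have D0: "?D x = 0" if "x \<notin> cball p r" for x
    by (rule derivative_zero_if_locally_zero[OF df, of "- cball p r"]) (use that f0 in auto)
  have far: "x \<notin> cball p r" if "norm x > ?R" for x
    using that norm_triangle_ineq[of p "x - p"] by (auto simp: dist_norm norm_minus_commute)
  have intD: "integrable lborel ?D"
    by (rule integrable_continuous_compact_support[OF contD, of ?R]) (use D0 far in blast)
  have 1: "set_integrable lborel \<Omega> ?D"
    unfolding set_integrable_def by (rule integrable_mult_indicator[OF _ intD]) (use op in auto)
  let ?g = "\<lambda>x. f x * (v \<bullet> \<nu> x)"
  let ?\<rho> = "\<lambda>x. indicator ?S x * indicator W (graph_point e \<gamma> x) * norm (e - limit_grad \<gamma> x)"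
  let ?h = "\<lambda>x. indicator ?S x * (f (graph_point e \<gamma> x) * (v \<bullet> (e - limit_grad \<gamma> x)))"
  have Sm[measurable]: "?S \<in> sets borel"
    by measurable
  have gm: "?g \<in> borel_measurable borel"
    by measurable
  have AEeq: "AE x in lborel. ?\<rho> x * ?g (graph_point e \<gamma> x) = ?h x"
    using diff
  proof eventually_elim
    case (elim x)
    show ?case
    proof (cases "graph_point e \<gamma> x \<in> W")
      case True
      let ?z = "e - limit_grad \<gamma> x"
      have "\<nu> (graph_point e \<gamma> x) = (1 / norm ?z) *\<^sub>R ?z"
        using \<nu> chart True elim by (simp add: outward_unit_normal_def limit_grad_eq_grad)
      then have "norm ?z *\<^sub>R \<nu> (graph_point e \<gamma> x) = ?z"
        by simp
      then have "norm ?z * (v \<bullet> \<nu> (graph_point e \<gamma> x)) = v \<bullet> ?z"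
        by (metis inner_scaleR_right)
      then show ?thesis
        using True by (simp add: mult_ac)
    next
      case False
      then have "f (graph_point e \<gamma> x) = 0"
        using f0 pW by blast
      then show ?thesis by simp
    qed
  qed
  have inth: "integrable lborel ?h"
    by (rule shifted_slab_tendsto(2)[where R = ?R, OF e inv lip diff contf]) (use f0 far in blast)
  have m1: "(\<lambda>x. ?\<rho> x * ?g (graph_point e \<gamma> x)) \<in> borel_measurable lborel"
    by measurable
  have m2: "?h \<in> borel_measurable lborel"
    using inth by auto
  have int\<rho>: "integrable lborel (\<lambda>x. ?\<rho> x * ?g (graph_point e \<gamma> x))"
    using integrable_cong_AE[OF m1 m2 AEeq] inth by simp
  have fr: "(\<lambda>x. indicator (frontier \<Omega> \<inter> W) x * ?g x) = (\<lambda>x. indicator (frontier \<Omega>) x *\<^sub>R ?g x)"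
    using f0 pW by (auto simp: fun_eq_iff indicator_def subset_iff)
  have 2: "set_integrable \<sigma> (frontier \<Omega>) ?g"
    unfolding set_integrable_def fr[symmetric] chart_surface_integral(2)[OF \<sigma> chart op gm] by (rule int\<rho>)
  have "(LINT x:\<Omega>|lborel. ?D x) = (\<integral>x. indicator {x. x \<bullet> e < \<gamma> x} x * ?D x \<partial>lborel)"
    unfolding set_lebesgue_integral_def
  proof (rule Bochner_Integration.integral_cong)
    show "indicator \<Omega> x *\<^sub>R ?D x = indicator {x. x \<bullet> e < \<gamma> x} x * ?D x" for x
      using \<Omega>[of x] D0[of x] pW by (cases "x \<in> cball p r") (auto simp: indicator_def)
  qed simp
  also have "\<dots> = (\<integral>x. ?h x \<partial>lborel)"
    by (rule undergraph_Gauss[where R = ?R, OF e inv lip diff df contD]) (use f0 far in blast)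
  also have "\<dots> = (\<integral>x. ?\<rho> x * ?g (graph_point e \<gamma> x) \<partial>lborel)"
    by (rule integral_cong_AE[OF m1 m2 AEeq, symmetric])
  also have "\<dots> = (LINT x:frontier \<Omega>|\<sigma>. ?g x)"
    unfolding set_lebesgue_integral_def fr[symmetric] by (rule chart_surface_integral(1)[OF \<sigma> chart op gm, symmetric])
  finally show ?thesis
    using 1 2 by (simp add: Gauss_identity_def)
qed

lemma Gauss_identity_add:
  assumes "C1_on S f" "C1_on S g" "\<Omega> \<subseteq> S" "open \<Omega>"
    and "Gauss_identity \<Omega> \<sigma> \<nu> v f" "Gauss_identity \<Omega> \<sigma> \<nu> v g"
  shows "Gauss_identity \<Omega> \<sigma> \<nu> v (\<lambda>x. f x + g x)"
proof -
  have D: "frechet_derivative (\<lambda>x. f x + g x) (at x) v = frechet_derivative f (at x) v + frechet_derivative g (at x) v"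
    if "x \<in> \<Omega>" for x
  proof -
    have x: "x \<in> S"
      using that assms(3) by auto
    show ?thesis
      using frechet_derivative_at[OF has_derivative_add[OF C1_on_derivative[OF assms(1) x] C1_on_derivative[OF assms(2) x]]]
      by (rule fun_cong[OF sym, of _ _ v])
  qed
  have 1: "set_integrable lborel \<Omega> (\<lambda>x. frechet_derivative (\<lambda>x. f x + g x) (at x) v)
      \<longleftrightarrow> set_integrable lborel \<Omega> (\<lambda>x. frechet_derivative f (at x) v + frechet_derivative g (at x) v)"
    by (rule set_integrable_cong) (simp_all add: D)
  have 2: "(LINT x:\<Omega>|lborel. frechet_derivative (\<lambda>x. f x + g x) (at x) v)
      = (LINT x:\<Omega>|lborel. frechet_derivative f (at x) v + frechet_derivative g (at x) v)"
    by (rule set_lebesgue_integral_cong) (use assms(4) D in auto)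
  show ?thesis
    using assms(5,6) unfolding Gauss_identity_def 1 2
    by (simp add: distrib_right set_integral_add)
qed

lemma Gauss_identity_cong:
  assumes "open \<Omega>" "C1_on \<Omega> f" "\<And>x. x \<in> closure \<Omega> \<Longrightarrow> f x = g x" "Gauss_identity \<Omega> \<sigma> \<nu> v f"
  shows "Gauss_identity \<Omega> \<sigma> \<nu> v g"
proof -
  have "frechet_derivative g (at x) v = frechet_derivative f (at x) v" if "x \<in> \<Omega>" for x
  proof -
    have "(g has_derivative frechet_derivative f (at x)) (at x)"
      by (rule has_derivative_transform_within_open[OF C1_on_derivative[OF assms(2) that] assms(1) that])
         (use assms(3) closure_subset in auto)
    from frechet_derivative_at[OF this] show ?thesis
      by simp
  qed
  moreover have "g x = f x" if "x \<in> frontier \<Omega>" for x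
    using that assms(3) by (auto simp: frontier_def)
  ultimately have "(\<lambda>x. indicator \<Omega> x *\<^sub>R frechet_derivative g (at x) v) = (\<lambda>x. indicator \<Omega> x *\<^sub>R frechet_derivative f (at x) v)"
    "(\<lambda>x. indicator (frontier \<Omega>) x *\<^sub>R (g x * (v \<bullet> \<nu> x))) = (\<lambda>x. indicator (frontier \<Omega>) x *\<^sub>R (f x * (v \<bullet> \<nu> x)))"
    by (auto simp: fun_eq_iff indicator_def)
  then show ?thesis
    using assms(4) by (simp add: Gauss_identity_def set_integrable_def set_lebesgue_integral_def)
qed

text \<open>
  Localisation. Each point \<open>p\<close> of the closure has a plateau function \<open>c p\<close> supported in a chart, and
  finitely many plateaus cover the closure. There \<open>\<Prod>p\<in>T. (1 - c p x)\<close> is zero, so \<open>f\<close> equals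
  \<open>f (1 - \<Prod>p\<in>T. (1 - c p))\<close>, which is built up by adding one function
  \<open>f c\<^sub>p (\<Prod>q. (1 - c\<^sub>q))\<close> at a time, supported in a single chart. The telescoping form avoids
  dividing by the sum of the cutoffs, which may vanish close to the boundary of the supports.
\<close>
theorem Gauss_theorem:
  fixes \<Omega> :: "(real^'k) set"
  assumes \<Omega>: "lipschitz_domain \<Omega>" and \<sigma>: "surface_measure \<Omega> \<sigma>" and \<nu>: "outward_unit_normal \<Omega> \<nu>"
    and S: "open S" "closure \<Omega> \<subseteq> S" and f: "C1_on S f"
  shows "Gauss_identity \<Omega> \<sigma> \<nu> v f"
proof -
  have op: "open \<Omega>" and bd: "bounded \<Omega>"
    using \<Omega> by (auto simp: lipschitz_domain_def)
  have \<Omega>S: "\<Omega> \<subseteq> S"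
    using S(2) closure_subset by blast
  have "\<forall>p\<in>closure \<Omega>. \<exists>r. r > 0 \<and> cball p r \<subseteq> S \<and> (\<exists>W e \<gamma>. graph_chart \<Omega> W e \<gamma> \<and> cball p r \<subseteq> W)"
  proof
    fix p assume p: "p \<in> closure \<Omega>"
    from closure_has_chart[OF \<Omega> p] obtain W e \<gamma> where W: "p \<in> W" "graph_chart \<Omega> W e \<gamma>"
      by blast
    then have "open (S \<inter> W)" "p \<in> S \<inter> W"
      using S p by (auto simp: graph_chart_def)
    then obtain r where "r > 0" "cball p r \<subseteq> S \<inter> W"
      by (meson open_contains_cball)
    then have "r > 0 \<and> cball p r \<subseteq> S \<and> graph_chart \<Omega> W e \<gamma> \<and> cball p r \<subseteq> W"
      using W by simp
    then show "\<exists>r. r > 0 \<and> cball p r \<subseteq> S \<and> (\<exists>W e \<gamma>. graph_chart \<Omega> W e \<gamma> \<and> cball p r \<subseteq> W)"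
      by blast
  qed
  from bchoice[OF this] obtain r where r': "\<forall>p\<in>closure \<Omega>. r p > 0 \<and> cball p (r p) \<subseteq> S
      \<and> (\<exists>W e \<gamma>. graph_chart \<Omega> W e \<gamma> \<and> cball p (r p) \<subseteq> W)"
    by (rule exE)
  have r: "r p > 0" and rS: "cball p (r p) \<subseteq> S"
    and chart: "\<exists>W e \<gamma>. graph_chart \<Omega> W e \<gamma> \<and> cball p (r p) \<subseteq> W" if "p \<in> closure \<Omega>" for p
    using bspec[OF r' that] by simp_all
  have "\<forall>p\<in>closure \<Omega>. \<exists>c. C1_on UNIV c \<and> (\<forall>x. dist p x \<le> r p / 2 \<longrightarrow> c x = (1::real)) \<and> (\<forall>x. dist p x \<ge> r p \<longrightarrow> c x = 0)"
    by (intro ballI C1_cutoff r)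
  from bchoice[OF this] obtain c where c': "\<forall>p\<in>closure \<Omega>. C1_on UNIV (c p)
      \<and> (\<forall>x. dist p x \<le> r p / 2 \<longrightarrow> c p x = (1::real)) \<and> (\<forall>x. dist p x \<ge> r p \<longrightarrow> c p x = 0)"
    by (rule exE)
  have c: "C1_on UNIV (c p)" and c1: "\<And>x. dist p x \<le> r p / 2 \<Longrightarrow> c p x = 1"
    and c0: "\<And>x. dist p x \<ge> r p \<Longrightarrow> c p x = 0" if "p \<in> closure \<Omega>" for p
    using bspec[OF c' that] by simp_all
  have cover: "closure \<Omega> \<subseteq> (\<Union>p\<in>closure \<Omega>. ball p (r p / 2))"
    using r by force
  have "compact (closure \<Omega>)"
    using bd by (simp add: compact_closure)
  then obtain T where T: "T \<subseteq> closure \<Omega>" "finite T" "closure \<Omega> \<subseteq> (\<Union>p\<in>T. ball p (r p / 2))"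
    by (rule compactE_image[OF _ _ cover]) auto
  have cS: "C1_on S (c p)" if "p \<in> closure \<Omega>" for p
    using C1_on_subset[OF c[OF that]] by simp
  define \<pi> where "\<pi> T x = (\<Prod>p\<in>T. 1 - c p x)" for T x
  have \<pi>: "C1_on S (\<pi> T)" if "T \<subseteq> closure \<Omega>" for T
    unfolding \<pi>_def using that by (intro C1_on_prod C1_on_diff C1_on_const cS) auto
  have part: "Gauss_identity \<Omega> \<sigma> \<nu> v (\<lambda>x. f x * (1 - \<pi> T x))" if "finite T" "T \<subseteq> closure \<Omega>" for T
    using that
  proof (induction T)
    case empty
    then show ?case
      by (simp add: \<pi>_def Gauss_identity_def set_integrable_def set_lebesgue_integral_def)
  next
    case (insert p T)
    then have p: "p \<in> closure \<Omega>" and TT: "T \<subseteq> closure \<Omega>"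
      by auto
    let ?g = "\<lambda>x. f x * \<pi> T x * c p x"
    have gS: "C1_on S ?g"
      by (intro C1_on_mult f \<pi> TT cS p)
    \<comment> \<open>The product is smooth on all of space although \<open>f\<close> is only given on \<open>S\<close>: it vanishes
    outside a closed ball contained in \<open>S\<close>.\<close>
    have "C1_on (- cball p (r p)) ?g"
      by (rule C1_on_cong_open[of _ "\<lambda>_. 0"]) (use c0[OF p] in \<open>auto intro: C1_on_const\<close>)
    then have "C1_on (S \<union> - cball p (r p)) ?g"
      by (intro C1_on_Un S gS) auto
    moreover have "S \<union> - cball p (r p) = UNIV"
      using rS[OF p] by auto
    ultimately have g: "C1_on UNIV ?g"
      by simp
    from chart[OF p] obtain W e \<gamma> where W: "graph_chart \<Omega> W e \<gamma>" "cball p (r p) \<subseteq> W"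
      by blast
    have Gg: "Gauss_identity \<Omega> \<sigma> \<nu> v ?g"
      by (rule Gauss_identity_local[OF op \<sigma> \<nu> W g]) (use c0[OF p] in auto)
    have "C1_on S (\<lambda>x. f x * (1 - \<pi> T x))"
      by (intro C1_on_mult f C1_on_diff C1_on_const \<pi> TT)
    from Gauss_identity_add[OF this gS \<Omega>S op insert.IH[OF TT] Gg]
    have "Gauss_identity \<Omega> \<sigma> \<nu> v (\<lambda>x. f x * (1 - \<pi> T x) + ?g x)" .
    moreover have "(\<lambda>x. f x * (1 - \<pi> T x) + ?g x) = (\<lambda>x. f x * (1 - \<pi> (insert p T) x))"
      using insert.hyps by (simp add: \<pi>_def fun_eq_iff algebra_simps)
    ultimately show ?case
      by simp
  qed
  have C: "C1_on \<Omega> (\<lambda>x. f x * (1 - \<pi> T x))"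
    by (rule C1_on_subset[OF _ \<Omega>S]) (intro C1_on_mult f C1_on_diff C1_on_const \<pi> T)
  have "f x * (1 - \<pi> T x) = f x" if "x \<in> closure \<Omega>" for x
  proof -
    from T(3) that obtain p where p: "p \<in> T" "dist p x \<le> r p / 2"
      by force
    then have "1 - c p x = 0"
      using c1 T(1) by auto
    then have "\<pi> T x = 0"
      using p(1) T(2) by (auto simp: \<pi>_def)
    then show ?thesis by simp
  qed
  then show ?thesis
    by (rule Gauss_identity_cong[OF op C _ part[OF T(2,1)]])
qed

section \<open>Matrix fields and smooth fields\<close>

lemma bounded_bilinear_matrix_vector_mult:
  "bounded_bilinear ((*v) :: real^'n^'m \<Rightarrow> real^'n \<Rightarrow> real^'m)"
  unfolding bilinear_conv_bounded_bilinear[symmetric] bilinear_def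
  by (auto intro!: linearI simp: matrix_vector_right_distrib matrix_vector_mult_scaleR
      matrix_vector_mult_add_rdistrib scaleR_matrix_vector_assoc)

lemma inner_transpose_mult: "u \<bullet> (transpose A *v w) = w \<bullet> (A *v u)" for A :: "real^'n^'m"
  by (simp add: dot_lmul_matrix inner_commute[of u])

lemma skew_quadratic_form_zero:
  fixes A :: "real^'n^'n"
  assumes "A + transpose A = 0"
  shows "u \<bullet> (A *v u) = 0"
proof -
  have "u \<bullet> ((A + transpose A) *v u) = 0"
    by (simp add: assms)
  then show ?thesis
    by (simp add: matrix_vector_mult_add_rdistrib inner_add_right inner_transpose_mult
        del: transpose_matrix_vector)
qed

lemma C1_on_Pair:
  assumes "C1_on S f" "C1_on S g"
  shows "C1_on S (\<lambda>x. (f x, g x))"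
proof (rule C1_onI)
  show "((\<lambda>x. (f x, g x)) has_derivative (\<lambda>v. (frechet_derivative f (at x) v, frechet_derivative g (at x) v))) (at x)"
    if "x \<in> S" for x
    by (intro has_derivative_Pair C1_on_derivative[OF assms(1) that] C1_on_derivative[OF assms(2) that])
  show "continuous_on S (\<lambda>x. (frechet_derivative f (at x) v, frechet_derivative g (at x) v))" for v
    by (intro continuous_on_Pair C1_on_continuous_derivative assms)
qed

lemma C1_on_vec:
  fixes f :: "'j::finite \<Rightarrow> 'a::euclidean_space \<Rightarrow> real^'n"
  assumes "\<And>j. C1_on S (f j)"
  shows "C1_on S (\<lambda>x. \<chi> j. f j x)"
proof -
  have ax: "bounded_linear (axis j :: real^'n \<Rightarrow> (real^'n)^'j)" for j
    unfolding linear_conv_bounded_linear[symmetric]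
    by (rule linearI) (simp_all add: axis_def vec_eq_iff)
  have "C1_on S (\<lambda>x. \<Sum>j\<in>UNIV. axis j (f j x))"
    by (rule C1_on_sum) (rule C1_on_bounded_linear[OF ax assms])
  also have "(\<lambda>x. \<Sum>j\<in>UNIV. axis j (f j x)) = (\<lambda>x. \<chi> j. f j x)"
    by (simp add: fun_eq_iff vec_eq_iff axis_def)
  finally show ?thesis .
qed

lemma C1_on_inner:
  "C1_on S f \<Longrightarrow> C1_on S g \<Longrightarrow> C1_on S (\<lambda>x. f x \<bullet> g x)"
  by (rule C1_on_bounded_bilinear[OF bounded_bilinear_inner])

lemma C1_on_ident: "C1_on S (\<lambda>x. x)"
  by (rule C1_onI[where f' = "\<lambda>_ v. v"]) (auto intro!: derivative_eq_intros)

lemma smooth_near_UNIV_imp_C1_on: "smooth_near UNIV f \<Longrightarrow> C1_on S f"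
proof -
  assume "smooth_near UNIV f"
  then obtain T where T: "UNIV \<subseteq> T" "ck_on (Suc 0) T f"
    unfolding smooth_near_def by blast
  then have "C1_on T f"
    by (simp add: C1_on_def)
  then show "C1_on S f"
    by (rule C1_on_subset) (use T in auto)
qed

lemma ck_on_imp_C1_on:
  assumes "ck_on (Suc (Suc 0)) S f"
  shows "C1_on S f" and "C1_on S (\<lambda>z. frechet_derivative f (at z) v)"
proof -
  have d: "\<forall>x\<in>S. f differentiable (at x)" and c: "\<And>v. C1_on S (\<lambda>z. frechet_derivative f (at z) v)"
    using assms by (simp_all add: C1_on_def)
  show "C1_on S (\<lambda>z. frechet_derivative f (at z) v)"
    by (rule c)
  show "C1_on S f"
    unfolding C1_on_def using d C1_on_imp_continuous_on[OF c] by blast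
qed

lemma smooth_fieldE:
  fixes U :: "('k::finite, 'n::finite) field"
  assumes "smooth_field \<Omega> U"
  obtains S where "open S" "{0..} \<times> closure \<Omega> \<subseteq> S" "C1_on S (\<lambda>(t, x). U t x)"
    "\<forall>v. C1_on S (\<lambda>z. frechet_derivative (\<lambda>(t, x). U t x) (at z) v)"
proof -
  from assms obtain S where S: "open S" "{0..} \<times> closure \<Omega> \<subseteq> S" and ck: "\<And>k. ck_on k S (\<lambda>(t, x). U t x)"
    unfolding smooth_field_def smooth_near_def by blast
  show thesis
    by (rule that[OF S ck_on_imp_C1_on(1)[OF ck] allI[OF ck_on_imp_C1_on(2)[OF ck]]])
qed

abbreviation section_at :: "real \<Rightarrow> (real \<times> 'a) set \<Rightarrow> 'a set" where
  "section_at t S \<equiv> Pair t -` S"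

lemma open_section_at: "open S \<Longrightarrow> open (section_at t S)" for S :: "(real \<times> 'a::topological_space) set"
  by (rule open_vimage) (auto intro: continuous_intros)

lemma C1_on_section:
  fixes W :: "real \<times> 'a::euclidean_space \<Rightarrow> 'b::euclidean_space"
  assumes "C1_on S W"
  shows "C1_on (section_at t S) (\<lambda>x. W (t, x))"
  by (rule C1_on_compose[where f = "\<lambda>x. (t, x)", OF _ assms])
     (auto intro: C1_on_Pair C1_on_const C1_on_ident)

lemma has_derivative_space_section:
  assumes "C1_on S (\<lambda>(t, x). U t x)" "(t, x) \<in> S"
  shows "(U t has_derivative (\<lambda>v. frechet_derivative (\<lambda>(t, x). U t x) (at (t, x)) (0, v))) (at x)"
proof -
  have "((\<lambda>x. (t, x)) has_derivative (\<lambda>v. (0, v))) (at x)"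
    by (auto intro!: derivative_eq_intros)
  from has_derivative_compose[OF this C1_on_derivative[OF assms]]
  show ?thesis by simp
qed

lemma dx_section:
  assumes "C1_on S (\<lambda>(t, x). U t x)" "(t, x) \<in> S"
  shows "dx i (U t) x = frechet_derivative (\<lambda>(t, x). U t x) (at (t, x)) (0, axis i 1)"
  unfolding dx_def
  by (rule fun_cong[OF frechet_derivative_at[OF has_derivative_space_section[OF assms]], symmetric])

lemma has_vector_derivative_time_section:
  assumes "C1_on S (\<lambda>(t, x). U t x)" "(t, x) \<in> S"
  shows "((\<lambda>s. U s x) has_vector_derivative frechet_derivative (\<lambda>(t, x). U t x) (at (t, x)) (1, 0)) (at t)"
proof -
  let ?D = "frechet_derivative (\<lambda>(t, x). U t x) (at (t, x))"
  have "((\<lambda>s. (s, x)) has_derivative (\<lambda>s. (s, 0))) (at t)"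
    by (auto intro!: derivative_eq_intros)
  from has_derivative_compose[OF this C1_on_derivative[OF assms]]
  have "((\<lambda>s. U s x) has_derivative (\<lambda>s. ?D (s, 0))) (at t)"
    by simp
  moreover have "(\<lambda>s. ?D (s, 0)) = (\<lambda>s. s *\<^sub>R ?D (1, 0))"
  proof
    show "?D (s, 0) = s *\<^sub>R ?D (1, 0)" for s
      using linear_cmul[OF has_derivative_linear[OF C1_on_derivative[OF assms]], of s "(1, 0)"] by simp
  qed
  ultimately show ?thesis
    by (simp only: has_vector_derivative_def)
qed

lemma set_integrable_continuous_closure:
  fixes f :: "'a::euclidean_space \<Rightarrow> real"
  assumes "bounded \<Omega>" "open \<Omega>" "continuous_on (closure \<Omega>) f"
  shows "set_integrable lborel \<Omega> f"
proof (rule set_integrable_subset)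
  show "set_integrable lborel (closure \<Omega>) f"
    unfolding set_integrable_def
    using assms by (intro borel_integrable_compact) (auto simp: compact_closure)
  show "\<Omega> \<in> sets lborel"
    using assms(2) by simp
qed (rule closure_subset)

section \<open>The energy balance\<close>

text \<open>
  For fixed \<open>x\<close> the density \<open>U\<^sup>T P U\<close> is the time integral of \<open>2 U\<^sup>T P U\<^sub>t\<close>, because \<open>P\<close> is
  symmetric and independent of time. Integrating over the region and exchanging the two
  integrals gives the growth of the energy, and along the way the integrability in time of the
  rate, without differentiating under the integral sign.
\<close>
lemma energy_growth:
  fixes pr :: "('k::finite, 'n::finite) ibvp"
  assumes setting: "ibvp_setting pr" and U: "smooth_field (region pr) U" and t: "t \<ge> 0"
  defines "rate \<equiv> \<lambda>s. LINT x:region pr|lborel. 2 * (U s x \<bullet> (Pmat pr x *v vector_derivative (\<lambda>s. U s x) (at s)))"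
  shows "set_integrable lborel {0..t} rate"
    and "energy pr (U t) - energy pr (U 0) = (LINT s:{0..t}|lborel. rate s)"
proof -
  let ?\<Omega> = "region pr"
  from setting have op: "open ?\<Omega>" and bd: "bounded ?\<Omega>" and P: "continuous_on (closure ?\<Omega>) (Pmat pr)"
    and sym: "\<And>x. x \<in> closure ?\<Omega> \<Longrightarrow> transpose (Pmat pr x) = Pmat pr x"
    by (auto simp: ibvp_setting_def lipschitz_domain_def)
  from U obtain S where S: "open S" "{0..} \<times> closure ?\<Omega> \<subseteq> S" and C: "C1_on S (\<lambda>(t, x). U t x)"
    by (rule smooth_fieldE)
  note bil = bounded_bilinear.continuous_on[OF bounded_bilinear_matrix_vector_mult]
  let ?W = "\<lambda>(t, x). U t x"
  let ?Wt = "\<lambda>z. frechet_derivative ?W (at z) (1, 0)"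
  let ?K = "{0..t} \<times> closure ?\<Omega>"
  let ?H = "\<lambda>z. 2 * (?W z \<bullet> (Pmat pr (snd z) *v ?Wt z))"
  have KS: "?K \<subseteq> S"
    using S(2) by auto
  have Ut: "vector_derivative (\<lambda>s. U s x) (at s) = ?Wt (s, x)" if "(s, x) \<in> S" for s x
    by (rule vector_derivative_at[OF has_vector_derivative_time_section[OF C that]])
  have contW: "continuous_on ?K ?W"
    by (rule continuous_on_subset[OF C1_on_imp_continuous_on[OF C] KS])
  have contWt: "continuous_on ?K ?Wt"
    by (rule continuous_on_subset[OF C1_on_continuous_derivative[OF C] KS])
  have contP: "continuous_on ?K (\<lambda>z. Pmat pr (snd z))"
    by (rule continuous_on_compose2[OF P]) (auto intro!: continuous_intros)
  have "compact ?K"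
    using bd by (intro compact_Times) (auto simp: compact_closure)
  then have "set_integrable lborel ?K ?H"
    unfolding set_integrable_def
    by (rule borel_integrable_compact) (intro continuous_intros contW contWt contP bil)
  then have "set_integrable lborel ({0..t} \<times> ?\<Omega>) ?H"
  proof (rule set_integrable_subset)
    show "{0..t} \<times> ?\<Omega> \<in> sets lborel"
      using op by (simp add: borel_Times)
    show "{0..t} \<times> ?\<Omega> \<subseteq> ?K"
      by (intro Sigma_mono closure_subset order_refl)
  qed
  then have "integrable (lborel \<Otimes>\<^sub>M lborel) (\<lambda>z. indicator ({0..t} \<times> ?\<Omega>) z *\<^sub>R ?H z)"
    by (simp add: set_integrable_def lborel_prod)
  also have "(\<lambda>z. indicator ({0..t} \<times> ?\<Omega>) z *\<^sub>R ?H z)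
      = (\<lambda>(s, x). indicator {0..t} s *\<^sub>R (indicator ?\<Omega> x *\<^sub>R ?H (s, x)))"
    by (auto simp: fun_eq_iff indicator_def)
  finally have int: "integrable (lborel \<Otimes>\<^sub>M lborel)
      (\<lambda>(s, x). indicator {0..t} s *\<^sub>R (indicator ?\<Omega> x *\<^sub>R ?H (s, x)))" .
  have rate: "indicator {0..t} s *\<^sub>R rate s
      = (\<integral>x. indicator {0..t} s *\<^sub>R (indicator ?\<Omega> x *\<^sub>R ?H (s, x)) \<partial>lborel)" for s
  proof (cases "s \<in> {0..t}")
    case True
    have "indicator ?\<Omega> x *\<^sub>R (2 * (U s x \<bullet> (Pmat pr x *v vector_derivative (\<lambda>s. U s x) (at s))))
        = indicator ?\<Omega> x *\<^sub>R ?H (s, x)" for x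
    proof (cases "x \<in> ?\<Omega>")
      case x: True
      then have "(s, x) \<in> ?K"
        using True closure_subset by auto
      then have "(s, x) \<in> S"
        using KS by (rule subsetD[rotated])
      then show ?thesis
        by (simp add: Ut)
    qed simp
    then have "rate s = (\<integral>x. indicator ?\<Omega> x *\<^sub>R ?H (s, x) \<partial>lborel)"
      unfolding rate_def set_lebesgue_integral_def by (intro Bochner_Integration.integral_cong refl)
    then show ?thesis
      using True by (simp only: indicator_simps scaleR_one)
  qed simp
  show "set_integrable lborel {0..t} rate"
    unfolding set_integrable_def rate
    using lborel_pair.integrable_fst[OF int] by simp
  have slice: "(\<integral>s. indicator {0..t} s *\<^sub>R (indicator ?\<Omega> x *\<^sub>R ?H (s, x)) \<partial>lborel)
      = indicator ?\<Omega> x *\<^sub>R (U t x \<bullet> (Pmat pr x *v U t x)) - indicator ?\<Omega> x *\<^sub>R (U 0 x \<bullet> (Pmat pr x *v U 0 x))" for x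
  proof (cases "x \<in> ?\<Omega>")
    case True
    then have x: "x \<in> closure ?\<Omega>"
      using closure_subset by auto
    let ?q = "\<lambda>s. U s x \<bullet> (Pmat pr x *v U s x)"
    have der: "(?q has_vector_derivative ?H (s, x)) (at s within {0..t})" if "0 \<le> s" "s \<le> t" for s
    proof -
      have "(s, x) \<in> S"
        using that x KS by auto
      from has_vector_derivative_time_section[OF C this]
      have d: "((\<lambda>s. U s x) has_vector_derivative ?Wt (s, x)) (at s within {0..t})"
        by (rule has_vector_derivative_at_within)
      have "((\<lambda>s. Pmat pr x *v U s x) has_vector_derivative Pmat pr x *v ?Wt (s, x)) (at s within {0..t})"
        by (rule bounded_linear.has_vector_derivative[OF matrix_vector_mul_bounded_linear d])
      from bounded_bilinear.has_vector_derivative[OF bounded_bilinear_inner d this]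
      have "(?q has_vector_derivative U s x \<bullet> (Pmat pr x *v ?Wt (s, x)) + ?Wt (s, x) \<bullet> (Pmat pr x *v U s x)) (at s within {0..t})" .
      moreover have "?Wt (s, x) \<bullet> (Pmat pr x *v U s x) = U s x \<bullet> (Pmat pr x *v ?Wt (s, x))"
        using inner_transpose_mult[of "U s x" "Pmat pr x" "?Wt (s, x)"] sym[OF x] by simp
      ultimately show ?thesis by simp
    qed
    have "continuous_on {0..t} (\<lambda>s. ?H (s, x))"
    proof -
      have "continuous_on ?K ?H"
        by (intro continuous_intros contW contWt contP bil)
      then show ?thesis
        by (rule continuous_on_compose2[of ?K ?H _ "\<lambda>s. (s, x)"]) (use x in \<open>auto intro!: continuous_intros\<close>)
    qed
    from integral_FTC_atLeastAtMost[OF t der this] True show ?thesis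
      by simp
  qed simp
  have E: "set_integrable lborel ?\<Omega> (\<lambda>x. U s x \<bullet> (Pmat pr x *v U s x))" if "s \<in> {0..t}" for s
  proof (rule set_integrable_continuous_closure[OF bd op])
    have "continuous_on (closure ?\<Omega>) (\<lambda>x. ?W (s, x))"
      by (rule continuous_on_compose2[OF contW]) (use that in \<open>auto intro!: continuous_intros\<close>)
    then show "continuous_on (closure ?\<Omega>) (\<lambda>x. U s x \<bullet> (Pmat pr x *v U s x))"
      by (intro continuous_intros bil P) auto
  qed
  have "(LINT s:{0..t}|lborel. rate s) = (\<integral>s. (\<integral>x. indicator {0..t} s *\<^sub>R (indicator ?\<Omega> x *\<^sub>R ?H (s, x)) \<partial>lborel) \<partial>lborel)"
    unfolding set_lebesgue_integral_def rate ..
  also have "\<dots> = (\<integral>x. (\<integral>s. indicator {0..t} s *\<^sub>R (indicator ?\<Omega> x *\<^sub>R ?H (s, x)) \<partial>lborel) \<partial>lborel)"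
    by (rule lborel_pair.Fubini_integral[OF int, symmetric])
  also have "\<dots> = energy pr (U t) - energy pr (U 0)"
    unfolding slice energy_def set_lebesgue_integral_def
    by (rule Bochner_Integration.integral_diff) (use E[of t] E[of 0] t in \<open>simp_all add: set_integrable_def\<close>)
  finally show "energy pr (U t) - energy pr (U 0) = (LINT s:{0..t}|lborel. rate s)" ..
qed

text \<open>
  The quantity whose divergence appears when the equation is multiplied by \<open>U\<^sup>T\<close>; its normal
  component is the integrand of \<open>boundary_term\<close>.
\<close>
definition energy_flux ::
    "('k::finite, 'n::finite) ibvp \<Rightarrow> ('k, 'n) field \<Rightarrow> real \<Rightarrow> 'k \<Rightarrow> real^'k \<Rightarrow> real" where
  "energy_flux pr U t i x =
     U t x \<bullet> (Amat pr i (V_of pr U t x) *v U t x) - eps pr * (U t x \<bullet> visc pr i (U t) x)"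

text \<open>
  The divergence theorem needs functions that are continuously differentiable on a neighbourhood
  of the closure. The viscous flux contains first derivatives of \<open>U\<close>, so this uses two derivatives
  of \<open>U\<close>.
\<close>
lemma C1_on_coefficients:
  fixes pr :: "('k::finite, 'n::finite) ibvp"
  assumes setting: "ibvp_setting pr" and U: "smooth_field (region pr) U" and t: "t \<ge> 0"
  obtains T where "open T" "closure (region pr) \<subseteq> T" "C1_on T (U t)"
    "\<forall>i. C1_on T (\<lambda>x. Amat pr i (V_of pr U t x) *v U t x)" "\<forall>i. C1_on T (visc pr i (U t))"
proof -
  have A: "smooth_near UNIV (Amat pr i)" and D: "smooth_near UNIV (\<lambda>(u, p). Dflux pr i u p)" for i
    using setting by (auto simp: ibvp_setting_def)
  have V: "smooth_field (region pr) (V_of pr U)"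
    using setting U by (cases "coeff pr") (auto simp: ibvp_setting_def V_of_def)
  from U obtain S where S: "open S" "{0..} \<times> closure (region pr) \<subseteq> S" and C: "C1_on S (\<lambda>(t, x). U t x)"
    and C2: "\<forall>v. C1_on S (\<lambda>z. frechet_derivative (\<lambda>(t, x). U t x) (at z) v)"
    by (rule smooth_fieldE)
  from V obtain S' where S': "open S'" "{0..} \<times> closure (region pr) \<subseteq> S'" and C': "C1_on S' (\<lambda>(t, x). V_of pr U t x)"
    by (rule smooth_fieldE)
  define T where "T = section_at t S \<inter> section_at t S'"
  have T: "open T" "closure (region pr) \<subseteq> T"
    using S S' t by (auto simp: T_def intro!: open_Int open_section_at)
  have CU: "C1_on T (U t)"
    using C1_on_section[OF C, of t] by (auto simp: T_def intro: C1_on_subset)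
  have CV: "C1_on T (V_of pr U t)"
    using C1_on_section[OF C', of t] by (auto simp: T_def intro: C1_on_subset)
  have Cdx: "C1_on T (dx j (U t))" for j
  proof (rule C1_on_cong_open[OF T(1)])
    show "C1_on T (\<lambda>x. frechet_derivative (\<lambda>(t, x). U t x) (at (t, x)) (0, axis j 1))"
      by (rule C1_on_subset[OF C1_on_section[OF C2[rule_format]]]) (simp add: T_def)
    show "frechet_derivative (\<lambda>(t, x). U t x) (at (t, x)) (0, axis j 1) = dx j (U t) x" if "x \<in> T" for x
      by (rule dx_section[OF C, symmetric]) (use that in \<open>simp add: T_def\<close>)
  qed
  show thesis
  proof (rule that[OF T CU])
    show "\<forall>i. C1_on T (\<lambda>x. Amat pr i (V_of pr U t x) *v U t x)"
      by (rule allI, rule C1_on_bounded_bilinear[OF bounded_bilinear_matrix_vector_mult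
            C1_on_compose[OF CV smooth_near_UNIV_imp_C1_on[OF A] subset_UNIV] CU])
    show "\<forall>i. C1_on T (visc pr i (U t))"
      using C1_on_compose[OF C1_on_Pair[OF CU C1_on_vec[OF Cdx]] smooth_near_UNIV_imp_C1_on[OF D] subset_UNIV]
      by (simp add: visc_def[abs_def])
  qed
qed

lemma frechet_derivative_inner:
  assumes "C1_on S f" "C1_on S g" "x \<in> S"
  shows "frechet_derivative (\<lambda>x. f x \<bullet> g x) (at x) v
     = f x \<bullet> frechet_derivative g (at x) v + frechet_derivative f (at x) v \<bullet> g x"
  by (rule fun_cong[OF frechet_derivative_at[OF bounded_bilinear.FDERIV[OF bounded_bilinear_inner
        C1_on_derivative[OF assms(1,3)] C1_on_derivative[OF assms(2,3)]]], symmetric])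

text \<open>
  The pointwise formula rests on \<open>w \<bullet> A u = u \<bullet> A\<^sup>T w\<close>: the two parts of the split convective term
  \<open>(A\<^sub>i U)\<^sub>x + A\<^sub>i\<^sup>T U\<^sub>x\<close> are, after multiplication by \<open>U\<^sup>T\<close>, the two halves of the product rule for
  \<open>U\<^sup>T A\<^sub>i U\<close>. No derivative of \<open>A\<^sub>i(V)\<close> is left over, which is why the linear and the nonlinear
  problem are treated together.
\<close>
lemma divergence_energy_flux:
  fixes pr :: "('k::finite, 'n::finite) ibvp"
  assumes setting: "ibvp_setting pr" and U: "smooth_field (region pr) U" and t: "t \<ge> 0"
  shows "set_integrable lborel (region pr) (\<lambda>x. \<Sum>i\<in>UNIV. frechet_derivative (energy_flux pr U t i) (at x) (axis i 1))"
    and "(LINT x:region pr|lborel. \<Sum>i\<in>UNIV. frechet_derivative (energy_flux pr U t i) (at x) (axis i 1))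
       = boundary_term pr U t"
    and "x \<in> region pr \<Longrightarrow> frechet_derivative (energy_flux pr U t i) (at x) (axis i 1)
       = U t x \<bullet> dx i (\<lambda>y. Amat pr i (V_of pr U t y) *v U t y) x
         + U t x \<bullet> (transpose (Amat pr i (V_of pr U t x)) *v dx i (U t) x)
         - eps pr * (U t x \<bullet> dx i (visc pr i (U t)) x) - eps pr * (dx i (U t) x \<bullet> visc pr i (U t) x)"
proof -
  from setting have lip: "lipschitz_domain (region pr)" and \<sigma>: "surface_measure (region pr) (surf pr)"
    and \<nu>: "outward_unit_normal (region pr) (nrm pr)"
    by (auto simp: ibvp_setting_def)
  obtain T where T: "open T" "closure (region pr) \<subseteq> T" and CU: "C1_on T (U t)"
    and CA': "\<forall>i. C1_on T (\<lambda>x. Amat pr i (V_of pr U t x) *v U t x)" and Cv': "\<forall>i. C1_on T (visc pr i (U t))"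
    by (rule C1_on_coefficients[OF setting U t])
  note CA = CA'[rule_format] and Cv = Cv'[rule_format]
  have C1: "C1_on T (\<lambda>x. U t x \<bullet> (Amat pr i (V_of pr U t x) *v U t x))"
    and C2: "C1_on T (\<lambda>x. U t x \<bullet> visc pr i (U t) x)" for i
    by (rule C1_on_inner[OF CU CA], rule C1_on_inner[OF CU Cv])
  have C3: "C1_on T (\<lambda>x. eps pr * (U t x \<bullet> visc pr i (U t) x))" for i
    by (rule C1_on_mult[OF C1_on_const C2])
  have "C1_on T (energy_flux pr U t i)" for i
    unfolding energy_flux_def[abs_def] by (rule C1_on_diff[OF C1 C3])
  from Gauss_theorem[OF lip \<sigma> \<nu> T this]
  have G: "Gauss_identity (region pr) (surf pr) (nrm pr) (axis i 1) (energy_flux pr U t i)" for i .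
  then have G1: "set_integrable lborel (region pr) (\<lambda>x. frechet_derivative (energy_flux pr U t i) (at x) (axis i 1))"
    and G2: "set_integrable (surf pr) (frontier (region pr)) (\<lambda>x. energy_flux pr U t i x * (axis i 1 \<bullet> nrm pr x))"
    and G3: "(LINT x:region pr|lborel. frechet_derivative (energy_flux pr U t i) (at x) (axis i 1))
       = (LINT x:frontier (region pr)|surf pr. energy_flux pr U t i x * (axis i 1 \<bullet> nrm pr x))" for i
    by (simp_all add: Gauss_identity_def)
  show "set_integrable lborel (region pr) (\<lambda>x. \<Sum>i\<in>UNIV. frechet_derivative (energy_flux pr U t i) (at x) (axis i 1))"
    using G1 unfolding set_integrable_def scaleR_sum_right by (intro Bochner_Integration.integrable_sum)
  have "(LINT x:region pr|lborel. \<Sum>i\<in>UNIV. frechet_derivative (energy_flux pr U t i) (at x) (axis i 1))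
      = (\<Sum>i\<in>UNIV. LINT x:region pr|lborel. frechet_derivative (energy_flux pr U t i) (at x) (axis i 1))"
    using G1 unfolding set_integrable_def set_lebesgue_integral_def scaleR_sum_right
    by (intro Bochner_Integration.integral_sum)
  also have "\<dots> = (\<Sum>i\<in>UNIV. LINT x:frontier (region pr)|surf pr. energy_flux pr U t i x * (axis i 1 \<bullet> nrm pr x))"
    by (simp only: G3)
  also have "\<dots> = (LINT x:frontier (region pr)|surf pr. \<Sum>i\<in>UNIV. energy_flux pr U t i x * (axis i 1 \<bullet> nrm pr x))"
    using G2 unfolding set_integrable_def set_lebesgue_integral_def scaleR_sum_right
    by (intro Bochner_Integration.integral_sum[symmetric])
  also have "(\<lambda>x. \<Sum>i\<in>UNIV. energy_flux pr U t i x * (axis i 1 \<bullet> nrm pr x))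
     = (\<lambda>x. U t x \<bullet> ((\<Sum>i\<in>UNIV. nrm pr x $ i *\<^sub>R Amat pr i (V_of pr U t x)) *v U t x)
        - eps pr * (U t x \<bullet> (\<Sum>i\<in>UNIV. nrm pr x $ i *\<^sub>R visc pr i (U t) x)))"
  proof
    fix x
    have "(\<Sum>i\<in>UNIV. nrm pr x $ i *\<^sub>R Amat pr i (V_of pr U t x)) *v U t x
        = (\<Sum>i\<in>UNIV. nrm pr x $ i *\<^sub>R (Amat pr i (V_of pr U t x) *v U t x))"
      by (simp add: bounded_bilinear.sum_left[OF bounded_bilinear_matrix_vector_mult] scaleR_matrix_vector_assoc)
    then show "(\<Sum>i\<in>UNIV. energy_flux pr U t i x * (axis i 1 \<bullet> nrm pr x))
     = U t x \<bullet> ((\<Sum>i\<in>UNIV. nrm pr x $ i *\<^sub>R Amat pr i (V_of pr U t x)) *v U t x)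
        - eps pr * (U t x \<bullet> (\<Sum>i\<in>UNIV. nrm pr x $ i *\<^sub>R visc pr i (U t) x))"
      by (simp add: energy_flux_def inner_sum_right sum_distrib_left sum_subtractf[symmetric]
          inner_axis' left_diff_distrib right_diff_distrib mult_ac)
  qed
  finally show "(LINT x:region pr|lborel. \<Sum>i\<in>UNIV. frechet_derivative (energy_flux pr U t i) (at x) (axis i 1))
       = boundary_term pr U t"
    by (simp only: boundary_term_def)
  show "frechet_derivative (energy_flux pr U t i) (at x) (axis i 1)
       = U t x \<bullet> dx i (\<lambda>y. Amat pr i (V_of pr U t y) *v U t y) x
         + U t x \<bullet> (transpose (Amat pr i (V_of pr U t x)) *v dx i (U t) x)
         - eps pr * (U t x \<bullet> dx i (visc pr i (U t)) x) - eps pr * (dx i (U t) x \<bullet> visc pr i (U t) x)"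
    if "x \<in> region pr"
  proof -
    have x: "x \<in> T"
      using that T(2) closure_subset by auto
    have "(energy_flux pr U t i has_derivative
        (\<lambda>v. frechet_derivative (\<lambda>x. U t x \<bullet> (Amat pr i (V_of pr U t x) *v U t x)) (at x) v
           - eps pr * frechet_derivative (\<lambda>x. U t x \<bullet> visc pr i (U t) x) (at x) v)) (at x)"
      unfolding energy_flux_def[abs_def]
      by (intro has_derivative_diff has_derivative_mult_right C1_on_derivative[OF C1 x] C1_on_derivative[OF C2 x])
    from fun_cong[OF frechet_derivative_at[OF this], symmetric, where x = "axis i 1"]
    show ?thesis
      unfolding frechet_derivative_inner[OF CU CA x] frechet_derivative_inner[OF CU Cv x] dx_def[symmetric]
        inner_transpose_mult
      by (simp add: algebra_simps)
  qed
qed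

text \<open>
  Multiplying the equation by \<open>U\<^sup>T\<close> turns it into \<open>U\<^sup>T P U\<^sub>t = - div - \<epsilon> \<Sum>\<^sub>i U\<^sub>x\<^sup>T D\<^sub>i\<close>, where \<open>div\<close>
  is the divergence of \<open>energy_flux\<close>: the term with \<open>C\<close> is a skew quadratic form and vanishes, and
  the viscous term is a divergence minus the dissipation. The dissipation has a sign and is
  dropped, and the divergence theorem evaluates the rest.
\<close>
lemma energy_rate_le_boundary_term:
  fixes pr :: "('k::finite, 'n::finite) ibvp"
  assumes setting: "ibvp_setting pr" and eps: "eps pr > 0"
    and skew: "\<And>v. Cmat pr v + transpose (Cmat pr v) = 0"
    and U: "smooth_field (region pr) U" and t: "t \<ge> 0"
    and pde: "\<And>x. x \<in> region pr \<Longrightarrow> pde_at pr U t x"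
    and diss: "\<And>x i. x \<in> region pr \<Longrightarrow> dx i (U t) x \<bullet> visc pr i (U t) x \<ge> 0"
  shows "(LINT x:region pr|lborel. 2 * (U t x \<bullet> (Pmat pr x *v vector_derivative (\<lambda>s. U s x) (at t))))
      \<le> - 2 * boundary_term pr U t"
proof -
  let ?div = "\<lambda>x. \<Sum>i\<in>UNIV. frechet_derivative (energy_flux pr U t i) (at x) (axis i 1)"
  let ?r = "\<lambda>x. 2 * (U t x \<bullet> (Pmat pr x *v vector_derivative (\<lambda>s. U s x) (at t)))"
  have le: "?r x \<le> - 2 * ?div x" if x: "x \<in> region pr" for x
  proof -
    let ?V = "V_of pr U"
    have "Pmat pr x *v vector_derivative (\<lambda>s. U s x) (at t)
       + (\<Sum>i\<in>UNIV. dx i (\<lambda>y. Amat pr i (?V t y) *v U t y) x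
                    + transpose (Amat pr i (?V t x)) *v dx i (U t) x)
       + Cmat pr (?V t x) *v U t x
       = eps pr *\<^sub>R (\<Sum>i\<in>UNIV. dx i (visc pr i (U t)) x)"
      using pde[OF x] unfolding pde_at_def Let_def .
    then have "U t x \<bullet> (Pmat pr x *v vector_derivative (\<lambda>s. U s x) (at t)
       + (\<Sum>i\<in>UNIV. dx i (\<lambda>y. Amat pr i (?V t y) *v U t y) x
                    + transpose (Amat pr i (?V t x)) *v dx i (U t) x)
       + Cmat pr (?V t x) *v U t x)
       = U t x \<bullet> (eps pr *\<^sub>R (\<Sum>i\<in>UNIV. dx i (visc pr i (U t)) x))"
      by (rule arg_cong)
    moreover have "U t x \<bullet> (Cmat pr (?V t x) *v U t x) = 0"
      by (rule skew_quadratic_form_zero[OF skew])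
    ultimately have "U t x \<bullet> (Pmat pr x *v vector_derivative (\<lambda>s. U s x) (at t))
      = - (\<Sum>i\<in>UNIV. U t x \<bullet> dx i (\<lambda>y. Amat pr i (?V t y) *v U t y) x
          + U t x \<bullet> (transpose (Amat pr i (?V t x)) *v dx i (U t) x))
        + (\<Sum>i\<in>UNIV. eps pr * (U t x \<bullet> dx i (visc pr i (U t)) x))"
      by (simp add: inner_add_right inner_sum_right sum_distrib_left del: transpose_matrix_vector)
    moreover have "?div x = (\<Sum>i\<in>UNIV. U t x \<bullet> dx i (\<lambda>y. Amat pr i (?V t y) *v U t y) x
          + U t x \<bullet> (transpose (Amat pr i (?V t x)) *v dx i (U t) x))
        - (\<Sum>i\<in>UNIV. eps pr * (U t x \<bullet> dx i (visc pr i (U t)) x))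
        - (\<Sum>i\<in>UNIV. eps pr * (dx i (U t) x \<bullet> visc pr i (U t) x))"
      unfolding divergence_energy_flux(3)[OF setting U t x] by (simp only: sum_subtractf)
    moreover have "0 \<le> (\<Sum>i\<in>UNIV. eps pr * (dx i (U t) x \<bullet> visc pr i (U t) x))"
      using diss[OF x] eps by (intro sum_nonneg) simp
    ultimately show ?thesis
      by linarith
  qed
  have int: "set_integrable lborel (region pr) ?r"
  proof -
    from setting have op: "open (region pr)" and bd: "bounded (region pr)"
      and P: "continuous_on (closure (region pr)) (Pmat pr)"
      by (auto simp: ibvp_setting_def lipschitz_domain_def)
    from U obtain S where S: "{0..} \<times> closure (region pr) \<subseteq> S" and C: "C1_on S (\<lambda>(t, x). U t x)"
      by (rule smooth_fieldE)
    let ?D = "\<lambda>z. frechet_derivative (\<lambda>(t, x). U t x) (at z) (1, 0)"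
    have tS: "(t, x) \<in> S" if "x \<in> closure (region pr)" for x
      using S t that by auto
    have 1: "continuous_on (closure (region pr)) (\<lambda>x. case (t, x) of (t, x) \<Rightarrow> U t x)"
      by (rule continuous_on_compose2[OF C1_on_imp_continuous_on[OF C]]) (auto intro!: continuous_intros tS)
    have 2: "continuous_on (closure (region pr)) (\<lambda>x. ?D (t, x))"
      by (rule continuous_on_compose2[OF C1_on_continuous_derivative[OF C]]) (auto intro!: continuous_intros tS)
    have 3: "vector_derivative (\<lambda>s. U s x) (at t) = ?D (t, x)" if "x \<in> closure (region pr)" for x
      by (rule vector_derivative_at[OF has_vector_derivative_time_section[OF C tS[OF that]]])
    have "continuous_on (closure (region pr)) (\<lambda>x. 2 * ((case (t, x) of (t, x) \<Rightarrow> U t x) \<bullet> (Pmat pr x *v ?D (t, x))))"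
      by (intro continuous_intros 1 2 P bounded_bilinear.continuous_on[OF bounded_bilinear_matrix_vector_mult])
    then have "continuous_on (closure (region pr)) ?r"
      by (rule continuous_on_eq) (simp add: 3)
    then show ?thesis
      by (rule set_integrable_continuous_closure[OF bd op])
  qed
  have "set_integrable lborel (region pr) (\<lambda>x. - 2 * ?div x)"
    by (rule set_integrable_mult_right) (rule divergence_energy_flux(1)[OF setting U t])
  then have "(LINT x:region pr|lborel. ?r x) \<le> (LINT x:region pr|lborel. - 2 * ?div x)"
    by (rule set_integral_mono[OF int]) (rule le)
  also have "\<dots> = - 2 * (LINT x:region pr|lborel. ?div x)"
    by (rule set_integral_mult_right)
  also have "\<dots> = - 2 * boundary_term pr U t"
    by (simp only: divergence_energy_flux(2)[OF setting U t])
  finally show ?thesis .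
qed

lemma energy_le_of_boundary_bound:
  fixes pr :: "('k::finite, 'n::finite) ibvp"
  assumes setting: "ibvp_setting pr" and eps: "eps pr > 0"
    and skew: "\<And>v. Cmat pr v + transpose (Cmat pr v) = 0"
    and sol: "is_solution pr J F G U"
    and diss: "\<And>t x i. t \<ge> 0 \<Longrightarrow> x \<in> region pr \<Longrightarrow> dx i (U t) x \<bullet> visc pr i (U t) x \<ge> 0"
    and b: "\<And>t. t \<ge> 0 \<Longrightarrow> boundary_term pr U t \<ge> - b t"
    and intb: "set_integrable lborel {0..t} b" and t: "t \<ge> 0"
  shows "energy pr (U t) \<le> energy pr F + 2 * (LINT s:{0..t}|lborel. b s)"
proof -
  let ?rate = "\<lambda>s. LINT x:region pr|lborel. 2 * (U s x \<bullet> (Pmat pr x *v vector_derivative (\<lambda>s. U s x) (at s)))"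
  from sol have U: "smooth_field (region pr) U" and pde: "\<And>t x. t \<ge> 0 \<Longrightarrow> x \<in> region pr \<Longrightarrow> pde_at pr U t x"
    and F: "\<And>x. x \<in> region pr \<Longrightarrow> U 0 x = F x"
    by (auto simp: is_solution_def)
  have E0: "energy pr (U 0) = energy pr F"
    unfolding energy_def set_lebesgue_integral_def
    by (intro Bochner_Integration.integral_cong refl) (auto simp: indicator_def F)
  have "energy pr (U t) - energy pr F = (LINT s:{0..t}|lborel. ?rate s)"
    using energy_growth(2)[OF setting U t] by (simp only: E0)
  also have "\<dots> \<le> (LINT s:{0..t}|lborel. 2 * b s)"
  proof (rule set_integral_mono[OF energy_growth(1)[OF setting U t]])
    show "set_integrable lborel {0..t} (\<lambda>s. 2 * b s)"
      using intb by simp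
    show "?rate s \<le> 2 * b s" if "s \<in> {0..t}" for s
    proof -
      have s: "s \<ge> 0"
        using that by simp
      have "?rate s \<le> - 2 * boundary_term pr U s"
        by (rule energy_rate_le_boundary_term[OF setting eps skew U s pde[OF s] diss[OF s]])
      also have "\<dots> \<le> 2 * b s"
        using b[OF s] by simp
      finally show ?thesis .
    qed
  qed
  finally show ?thesis
    by simp
qed

section \<open>Boundary data and energy bounds\<close>

lemma data_energy_nonneg: "data_energy pr J G t \<ge> 0"
  unfolding data_energy_def set_lebesgue_integral_def
  by (intro Bochner_Integration.integral_nonneg) (auto simp: indicator_def intro: sum_nonneg)

lemma data_energy_zero: "data_energy pr J (\<lambda>_ _ _. 0) = (\<lambda>_. 0)"
  by (simp add: data_energy_def fun_eq_iff)

text \<open>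
  The lower bound with data is only assumed for \<open>G \<noteq> 0\<close>. A solution whose data vanish on the
  boundary solves the homogeneous problem too, and is covered by energy boundedness.
\<close>
lemma is_solution_zero_data:
  assumes "is_solution pr {..<nbc pr} F G U" "\<not> nonzero_data pr G"
  shows "is_solution pr {..<nbc pr} F (\<lambda>_ _ _. 0) U"
  using assms
  by (auto simp: is_solution_def nonzero_data_def admissible_data_def data_energy_zero set_integrable_def)

text \<open>
  With zero data the strong estimate is the plain one, so that conditions too few for the latter
  are too few for the former: minimality carries over.
\<close>
lemma strong_imp_energy_estimate:
  "strong_energy_estimate \<kappa> pr J \<Longrightarrow> energy_estimate pr J"
  unfolding strong_energy_estimate_def energy_estimate_def
proof (intro allI impI)
  fix F U and t :: real
  assume *: "\<forall>F G U. is_solution pr J F G U \<longrightarrow>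
      (\<forall>t\<ge>0. energy pr (U t) \<le> energy pr F + \<kappa> * (LINT s:{0..t}|lborel. data_energy pr J G s))"
    and sol: "is_solution pr J F (\<lambda>_ _ _. 0) U" and t: "t \<ge> 0"
  from *[rule_format, OF sol t] show "energy pr (U t) \<le> energy pr F"
    by (simp add: data_energy_zero)
qed

text \<open>
  The factor two comes from \<open>d/dt (U\<^sup>T P U) = 2 U\<^sup>T P U\<^sub>t\<close>: a boundary term bounded below by
  \<open>- c \<integral> G\<^sup>T G\<close> lets the energy grow at a rate of at most \<open>2 c \<integral> G\<^sup>T G\<close>.
\<close>
lemma strongly_energy_bounded_of_data_bound:
  fixes pr :: "('k::finite, 'n::finite) ibvp"
  assumes setting: "ibvp_setting pr" and eps: "eps pr > 0"
    and skew: "\<And>v. Cmat pr v + transpose (Cmat pr v) = 0"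
    and diss: "\<forall>F G U. is_solution pr {..<nbc pr} F G U \<longrightarrow>
           (\<forall>t\<ge>0. \<forall>x\<in>region pr. \<forall>i. dx i (U t) x \<bullet> visc pr i (U t) x \<ge> 0)"
    and bounded: "energy_bounded pr" and lb: "data_lower_bound c pr" and c: "c \<ge> 0"
  shows "strongly_energy_bounded (2 * c) pr"
  unfolding strongly_energy_bounded_def
proof
  let ?J = "{..<nbc pr}"
  show "minimal_conditions (strong_energy_estimate (2 * c)) pr"
    using bounded strong_imp_energy_estimate unfolding energy_bounded_def minimal_conditions_def by blast
  show "strong_energy_estimate (2 * c) pr ?J"
    unfolding strong_energy_estimate_def
  proof (intro allI impI)
    fix F G U and t :: real
    assume sol: "is_solution pr ?J F G U" and t: "t \<ge> 0"
    show "energy pr (U t) \<le> energy pr F + 2 * c * (LINT s:{0..t}|lborel. data_energy pr ?J G s)"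
    proof (cases "nonzero_data pr G")
      case True
      have "set_integrable lborel {0..t} (data_energy pr ?J G)"
        using sol t by (simp add: is_solution_def admissible_data_def)
      then have int: "set_integrable lborel {0..t} (\<lambda>s. c * data_energy pr ?J G s)"
        by simp
      have d: "dx i (U s) x \<bullet> visc pr i (U s) x \<ge> 0" if "s \<ge> 0" "x \<in> region pr" for s x i
        using diss sol that by blast
      have b: "boundary_term pr U s \<ge> - (c * data_energy pr ?J G s)" if "s \<ge> 0" for s
        using lb sol True that unfolding data_lower_bound_def by fastforce
      show ?thesis
        using energy_le_of_boundary_bound[OF setting eps skew sol d b int t] by simp
    next
      case False
      from bounded is_solution_zero_data[OF sol False] t have "energy pr (U t) \<le> energy pr F"
        by (auto simp: energy_bounded_def energy_estimate_def)
      moreover have "0 \<le> (LINT s:{0..t}|lborel. data_energy pr ?J G s)"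
        unfolding set_lebesgue_integral_def
        by (intro Bochner_Integration.integral_nonneg) (simp add: data_energy_nonneg)
      ultimately show ?thesis
        using c by (simp add: add_increasing2)
    qed
  qed
qed

theorem proposition3p4:
  fixes pr :: "('k::finite, 'n::finite) ibvp"
  assumes "ibvp_setting pr"
    and "eps pr > 0"
    and "\<forall>v. Cmat pr v + transpose (Cmat pr v) = 0"
    and "\<forall>F G U. is_solution pr {..<nbc pr} F G U \<longrightarrow>
           (\<forall>t\<ge>0. \<forall>x\<in>region pr. \<forall>i. dx i (U t) x \<bullet> visc pr i (U t) x \<ge> 0)"
  shows "(minimal_conditions energy_estimate pr \<and>
          (\<forall>F U. is_solution pr {..<nbc pr} F (\<lambda>_ _ _. 0) U \<longrightarrow>
             (\<forall>t\<ge>0. boundary_term pr U t \<ge> 0))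
          \<longrightarrow> energy_bounded pr) \<and>
         (energy_bounded pr \<and> data_lower_bound 1 pr \<longrightarrow> strongly_energy_bounded 2 pr) \<and>
         (energy_bounded pr \<and> data_lower_bound (1/2) pr \<longrightarrow> strongly_energy_bounded 1 pr)"
proof (intro conjI impI)
  let ?J = "{..<nbc pr}"
  note skew = assms(3)[rule_format]
  show "energy_bounded pr"
    if h: "minimal_conditions energy_estimate pr \<and>
          (\<forall>F U. is_solution pr ?J F (\<lambda>_ _ _. 0) U \<longrightarrow> (\<forall>t\<ge>0. boundary_term pr U t \<ge> 0))"
    unfolding energy_bounded_def
  proof
    show "minimal_conditions energy_estimate pr"
      using h by blast
    show "energy_estimate pr ?J"
      unfolding energy_estimate_def
    proof (intro allI impI)
      fix F U and t :: real
      assume sol: "is_solution pr ?J F (\<lambda>_ _ _. 0) U" and t: "t \<ge> 0"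
      have d: "dx i (U s) x \<bullet> visc pr i (U s) x \<ge> 0" if "s \<ge> 0" "x \<in> region pr" for s x i
        using assms(4) sol that by blast
      have b: "boundary_term pr U s \<ge> - 0" if "s \<ge> 0" for s
        using h sol that by simp
      have int: "set_integrable lborel {0..t} (\<lambda>_. 0 :: real)"
        by (simp add: set_integrable_def)
      show "energy pr (U t) \<le> energy pr F"
        using energy_le_of_boundary_bound[OF assms(1,2) skew sol d, of "\<lambda>_. 0", OF _ _ b int t] by simp
    qed
  qed
  show "strongly_energy_bounded 2 pr" if "energy_bounded pr \<and> data_lower_bound 1 pr"
    using strongly_energy_bounded_of_data_bound[OF assms(1,2) skew assms(4), of 1] that by simp
  show "strongly_energy_bounded 1 pr" if "energy_bounded pr \<and> data_lower_bound (1/2) pr"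
    using strongly_energy_bounded_of_data_bound[OF assms(1,2) skew assms(4), of "1/2"] that by simp
qed

end
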